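(* Let $q$ be a prime power and let $d, e_1, e_2$ be integers satisfying $1 < d/2 < e_1, e_2 \leq d$. Let $(g_1,g_2) \in \mathrm{GL}(d,q) \times \mathrm{GL}(d,q)$ be a $\mathrm{fat}(d,q;e_1,e_2)$-pair, and let $\mathcal{V} = \mathbb{F}_q^d$ be the natural $\mathbb{F}_q\mathrm{GL}(d,q)$-module. Then there exists an $\mathbb{F}_q\langle g_1,g_2\rangle$-composition factor $\mathcal{N}$ of $\mathcal{V}$ with $n = \dim(\mathcal{N}) \geq \max\{e_1,e_2\} > d/2$ such that, writing $\overline{g_i}$ for the element of $\mathrm{GL}(n,q)$ induced by $g_i$ on $\mathcal{N}$ (for $i=1,2$, with respect to a common basis of $\mathcal{N}$), the pair $(\overline{g_1},\overline{g_2})$ is an irreducible $\mathrm{fat}(n,q;e_1,e_2)$-pair.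
   Context: For a positive integer $m$, $\mathrm{GL}(m,q)$ is the group of invertible $m \times m$ matrices over the finite field $\mathbb{F}_q$ of order $q$; it acts on the space $\mathbb{F}_q^m$ of row vectors by right multiplication (vector times matrix), making $\mathbb{F}_q^m$ a right module for every subgroup (the natural module). For an integer $e$ with $m/2 < e \leq m$, an element $g \in \mathrm{GL}(m,q)$ is a $\mathrm{fat}(m,q;e)$-element if $\mathbb{F}_q^m$ has an irreducible $\mathbb{F}_q\langle g\rangle$-submodule of dimension $e$. A pair $(g_1,g_2) \in \mathrm{GL}(m,q)\times\mathrm{GL}(m,q)$ is a $\mathrm{fat}(m,q;e_1,e_2)$-pair if $g_i$ is a $\mathrm{fat}(m,q;e_i)$-element for $i = 1,2$ (where $e_1,e_2$ need not be distinct). A pair $(g_1,g_2)$ is irreducible if $\mathbb{F}_q^m$ is irreducible as an $\mathbb{F}_q\langle g_1,g_2\rangle$-module. *)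

theory Defs
  imports
    "Jordan_Normal_Form.VS_Connect"
    "HOL-Algebra.Generated_Groups"
    "HOL-Algebra.AbelCoset"
    "HOL-Number_Theory.Prime_Powers"
begin

definition GL :: "nat \<Rightarrow> 'a::field mat monoid"
  where "GL m = units_of (ring_mat TYPE('a) m ())"

record ('g, 'k, 'v) gmodule = "('k, 'v) module" +
  act :: "'v \<Rightarrow> 'g \<Rightarrow> 'v"

text \<open>Vectors are row vectors and matrices act from the right; the row vector \<open>v g\<close>
  is computed as \<open>g\<^sup>T v\<close>.\<close>

definition natural_module :: "nat \<Rightarrow> ('a mat, 'a::field, 'a vec) gmodule"
  where "natural_module m =
    module.extend (module_vec TYPE('a) m) \<lparr>act = (\<lambda>v g. transpose_mat g *\<^sub>v v)\<rparr>"

text \<open>In what follows a group \<open>G\<close> acts linearly on \<open>M\<close>, so the submodules over the group algebra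
  of \<open>G\<close> are the \<open>G\<close>-invariant subspaces. A submodule \<open>W\<close> regarded as a module in its own right is
  \<open>M\<lparr>carrier := W\<rparr>\<close>.\<close>

definition gsubmodule :: "'g set \<Rightarrow> ('g, 'k::field, 'v) gmodule \<Rightarrow> 'v set \<Rightarrow> bool"
  where "gsubmodule G M W \<longleftrightarrow>
    VectorSpace.subspace class_ring W M \<and> (\<forall>g\<in>G. \<forall>w\<in>W. act M w g \<in> W)"

definition irreducible_module :: "'g set \<Rightarrow> ('g, 'k::field, 'v) gmodule \<Rightarrow> bool"
  where "irreducible_module G M \<longleftrightarrow>
    carrier M \<noteq> {\<zero>\<^bsub>M\<^esub>} \<and>
    (\<forall>W. gsubmodule G M W \<longrightarrow> W = {\<zero>\<^bsub>M\<^esub>} \<or> W = carrier M)"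

abbreviation gdim :: "('g, 'k::field, 'v) gmodule \<Rightarrow> nat"
  where "gdim M \<equiv> vectorspace.dim class_ring M"

text \<open>As in \<open>rcoset_mult\<close> for quotient rings, scalars and group elements act on a coset through
  its representatives: \<open>(x + U) g = x g + U\<close>, which is well defined when \<open>U\<close> is a submodule.\<close>

definition quotient_module ::
  "('g, 'k, 'v) gmodule \<Rightarrow> 'v set \<Rightarrow> ('g, 'k, 'v set) gmodule"
  where "quotient_module M U =
    \<lparr>carrier = a_rcosets\<^bsub>M\<^esub> U, monoid.mult = undefined, one = undefined,
     zero = U, add = (<+>\<^bsub>M\<^esub>),
     smult = (\<lambda>c X. \<Union>x\<in>X. U +>\<^bsub>M\<^esub> (c \<odot>\<^bsub>M\<^esub> x)),
     act = (\<lambda>X g. \<Union>x\<in>X. U +>\<^bsub>M\<^esub> (act M x g))\<rparr>"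

definition composition_series ::
  "'g set \<Rightarrow> ('g, 'k::field, 'v) gmodule \<Rightarrow> 'v set list \<Rightarrow> bool"
  where "composition_series G M Ws \<longleftrightarrow>
    Ws \<noteq> [] \<and> hd Ws = {\<zero>\<^bsub>M\<^esub>} \<and> last Ws = carrier M \<and>
    (\<forall>W\<in>set Ws. gsubmodule G M W) \<and>
    (\<forall>i. Suc i < length Ws \<longrightarrow>
      Ws ! i \<subseteq> Ws ! Suc i \<and>
      irreducible_module G (quotient_module (M\<lparr>carrier := Ws ! Suc i\<rparr>) (Ws ! i)))"

definition composition_factor ::
  "'g set \<Rightarrow> ('g, 'k::field, 'v) gmodule \<Rightarrow> ('g, 'k, 'v set) gmodule \<Rightarrow> bool"
  where "composition_factor G M N \<longleftrightarrow>
    (\<exists>Ws i. composition_series G M Ws \<and> Suc i < length Ws \<and>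
      N = quotient_module (M\<lparr>carrier := Ws ! Suc i\<rparr>) (Ws ! i))"

definition ordered_basis :: "('g, 'k::field, 'v) gmodule \<Rightarrow> 'v list \<Rightarrow> bool"
  where "ordered_basis M bs \<longleftrightarrow> distinct bs \<and> vectorspace.basis class_ring M (set bs)"

text \<open>The next three lemmas guarantee that \<open>gdim\<close>, \<open>irreducible_module\<close> and quantification over
  ordered bases are meaningful for composition factors of the natural module.\<close>

lemma vectorspace_natural_module:
  "vectorspace class_ring (natural_module m :: ('a mat, 'a::field, 'a vec) gmodule)"
proof (rule vs_criteria, goal_cases)
  case 4
  show ?case
  proof
    fix v assume "v \<in> carrier (natural_module m :: ('a mat, 'a, 'a vec) gmodule)"
    then show "\<exists>w\<in>carrier (natural_module m). v \<oplus>\<^bsub>natural_module m\<^esub> w = \<zero>\<^bsub>natural_module m\<^esub>"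
      by (intro bexI[of _ "- v"]) (auto simp: natural_module_def module.defs module_vec_def)
  qed
qed (auto simp: natural_module_def module.defs module_vec_def class_field
      add_smult_distrib_vec smult_add_distrib_vec comm_add_vec[of _ m])

lemma vectorspace_quotient_module:
  fixes M :: "('g, 'k::field, 'v) gmodule"
  assumes "VectorSpace.subspace class_ring U M"
  shows "vectorspace class_ring (quotient_module M U)"
proof -
  interpret M: vectorspace class_ring M
    using assms by (simp add: VectorSpace.subspace_def)
  interpret U: LinearCombinations.submodule class_ring U M
    using assms by (simp add: VectorSpace.subspace_def)
  have U_neg: "\<ominus>\<^bsub>M\<^esub> u \<in> U" if "u \<in> U" for u
  proof -
    have "(\<ominus>\<^bsub>class_ring\<^esub> \<one>\<^bsub>class_ring\<^esub>) \<odot>\<^bsub>M\<^esub> u \<in> U"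
      using that by (intro U.smult_closed) auto
    moreover have "u \<in> carrier M" using that U.subset by (rule subsetD[rotated])
    ultimately show ?thesis
      by (simp only: M.smult_minus_1)
  qed
  have "subgroup U (add_monoid M)"
    using U.subset U.zero_closed U.m_closed U_neg
    by (intro M.add.subgroupI) (simp_all only: empty_iff not_False_eq_True, blast)
  then have "additive_subgroup U M"
    by (simp add: additive_subgroup_def)
  then interpret U: abelian_subgroup U M
    by (intro abelian_subgroupI3 M.abelian_group_axioms)
  let ?Q = "quotient_module M U"
  have car: "carrier ?Q = (\<lambda>x. U +>\<^bsub>M\<^esub> x) ` carrier M"
    by (auto simp: quotient_module_def A_RCOSETS_def RCOSETS_def a_r_coset_def)
  have smult: "c \<odot>\<^bsub>?Q\<^esub> (U +>\<^bsub>M\<^esub> x) = U +>\<^bsub>M\<^esub> (c \<odot>\<^bsub>M\<^esub> x)" if x: "x \<in> carrier M" for c x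
  proof -
    have "U +>\<^bsub>M\<^esub> (c \<odot>\<^bsub>M\<^esub> y) = U +>\<^bsub>M\<^esub> (c \<odot>\<^bsub>M\<^esub> x)" if y: "y \<in> U +>\<^bsub>M\<^esub> x" for y
    proof -
      obtain u where u: "u \<in> U" "y = u \<oplus>\<^bsub>M\<^esub> x"
        using y by (auto simp: a_r_coset_def r_coset_def)
      have uM: "u \<in> carrier M" using u U.subset by auto
      have "c \<odot>\<^bsub>M\<^esub> y = c \<odot>\<^bsub>M\<^esub> u \<oplus>\<^bsub>M\<^esub> c \<odot>\<^bsub>M\<^esub> x"
        using u uM x by (simp add: M.smult_r_distr)
      moreover have "c \<odot>\<^bsub>M\<^esub> u \<in> U" using u by auto
      ultimately have "c \<odot>\<^bsub>M\<^esub> y \<in> U +>\<^bsub>M\<^esub> (c \<odot>\<^bsub>M\<^esub> x)"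
        by (auto simp: a_r_coset_def r_coset_def)
      then show ?thesis
        using x by (intro U.a_repr_independence'[symmetric]) auto
    qed
    with U.a_rcos_self[OF x] have "(\<Union>y\<in>U +>\<^bsub>M\<^esub> x. U +>\<^bsub>M\<^esub> (c \<odot>\<^bsub>M\<^esub> y)) = U +>\<^bsub>M\<^esub> (c \<odot>\<^bsub>M\<^esub> x)"
      by (intro UN_constant_eq ballI)
    then show ?thesis by (simp add: quotient_module_def)
  qed
  have add: "(U +>\<^bsub>M\<^esub> x) \<oplus>\<^bsub>?Q\<^esub> (U +>\<^bsub>M\<^esub> y) = U +>\<^bsub>M\<^esub> (x \<oplus>\<^bsub>M\<^esub> y)"
    if "x \<in> carrier M" "y \<in> carrier M" for x y
    using that by (simp add: quotient_module_def U.a_rcos_sum)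
  have zero: "\<zero>\<^bsub>?Q\<^esub> = U +>\<^bsub>M\<^esub> \<zero>\<^bsub>M\<^esub>"
    using U.subset by (simp add: quotient_module_def M.a_coset_add_zero)
  show ?thesis
  proof (rule vs_criteria)
    show "\<forall>X\<in>carrier ?Q. \<exists>Y\<in>carrier ?Q. X \<oplus>\<^bsub>?Q\<^esub> Y = \<zero>\<^bsub>?Q\<^esub>"
    proof
      fix X assume "X \<in> carrier ?Q"
      then obtain x where x: "x \<in> carrier M" "X = U +>\<^bsub>M\<^esub> x" by (auto simp: car)
      have "X \<oplus>\<^bsub>?Q\<^esub> (U +>\<^bsub>M\<^esub> (\<ominus>\<^bsub>M\<^esub> x)) = \<zero>\<^bsub>?Q\<^esub>"
        using x by (simp add: add zero M.r_neg)
      with x show "\<exists>Y\<in>carrier ?Q. X \<oplus>\<^bsub>?Q\<^esub> Y = \<zero>\<^bsub>?Q\<^esub>"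
        by (auto simp: car)
    qed
    show "\<forall>X Y. X \<in> carrier ?Q \<and> Y \<in> carrier ?Q \<longrightarrow> X \<oplus>\<^bsub>?Q\<^esub> Y = Y \<oplus>\<^bsub>?Q\<^esub> X"
      by (auto simp: car add M.a_comm)
  qed (auto simp: class_field car smult add zero M.smult_l_distr[simplified] M.smult_r_distr
      M.smult_assoc1[simplified] M.smult_one[simplified] M.a_assoc)
qed

lemma composition_factor_has_ordered_basis:
  assumes "composition_factor G (natural_module m :: ('a mat, 'a::{field,finite}, 'a vec) gmodule) N"
  shows "\<exists>bs. ordered_basis N bs \<and> length bs = gdim N"
proof -
  let ?V = "natural_module m :: ('a mat, 'a, 'a vec) gmodule"
  interpret V: vectorspace class_ring ?V
    by (rule vectorspace_natural_module)
  obtain Ws i where Ws: "composition_series G ?V Ws" "Suc i < length Ws"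
    and N: "N = quotient_module (?V\<lparr>carrier := Ws ! Suc i\<rparr>) (Ws ! i)"
    using assms by (auto simp: composition_factor_def)
  let ?W = "Ws ! Suc i" and ?U = "Ws ! i"
  have sub: "VectorSpace.subspace class_ring ?W ?V" "VectorSpace.subspace class_ring ?U ?V" "?U \<subseteq> ?W"
    using Ws by (auto simp: composition_series_def gsubmodule_def)
  interpret W: vectorspace class_ring "?V\<lparr>carrier := ?W\<rparr>"
    by (rule V.subspace_is_vs[OF sub(1)])
  have subW: "VectorSpace.subspace class_ring ?U (?V\<lparr>carrier := ?W\<rparr>)"
    using sub W.vectorspace_axioms W.module_axioms
    by (auto simp: VectorSpace.subspace_def LinearCombinations.submodule_def)
  interpret N: vectorspace class_ring N
    unfolding N by (rule vectorspace_quotient_module[OF subW])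
  have "?W \<subseteq> carrier_vec m"
    using sub(1) by (auto simp: VectorSpace.subspace_def LinearCombinations.submodule_def
      natural_module_def module.defs module_vec_def)
  moreover have "finite (carrier_vec m :: 'a vec set)"
  proof (rule finite_subset)
    show "carrier_vec m \<subseteq> vec_of_list ` {xs :: 'a list. set xs \<subseteq> UNIV \<and> length xs = m}"
    proof
      fix v :: "'a vec" assume "v \<in> carrier_vec m"
      then show "v \<in> vec_of_list ` {xs. set xs \<subseteq> UNIV \<and> length xs = m}"
        by (intro image_eqI[of _ vec_of_list "list_of_vec v"]) (simp_all add: vec_list)
    qed
    show "finite (vec_of_list ` {xs :: 'a list. set xs \<subseteq> UNIV \<and> length xs = m})"
      by (intro finite_imageI finite_lists_length_eq) simp
  qed
  ultimately have "finite ?W" by (rule finite_subset)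
  then have fin: "finite (carrier N)"
    by (simp add: N quotient_module_def A_RCOSETS_def RCOSETS_def)
  have "N.span (carrier N) = carrier N"
    by (meson N.in_own_span N.span_is_subset2 order_refl subset_antisym)
  with fin have "N.fin_dim"
    unfolding N.fin_dim_def by blast
  then obtain B where B: "finite B" "N.basis B"
    using N.finite_basis_exists by blast
  obtain bs where bs: "set bs = B" "distinct bs"
    using finite_distinct_list[OF B(1)] by blast
  with B show ?thesis
    by (intro exI[of _ bs]) (auto simp: ordered_basis_def N.dim_basis distinct_card)
qed

text \<open>Since matrices act on row vectors from the right, row \<open>i\<close> of the matrix induced by \<open>g\<close>
  consists of the coordinates of the image of the \<open>i\<close>-th basis vector.\<close>

definition induced_matrix ::
  "('g, 'k::field, 'v) gmodule \<Rightarrow> 'v list \<Rightarrow> 'g \<Rightarrow> 'k mat"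
  where "induced_matrix M bs g =
    (THE A. A \<in> carrier_mat (length bs) (length bs) \<and>
      (\<forall>i<length bs. act M (bs ! i) g =
        (\<Oplus>\<^bsub>M\<^esub>j\<in>{..<length bs}. A $$ (i, j) \<odot>\<^bsub>M\<^esub> bs ! j)))"

definition fat_element :: "nat \<Rightarrow> nat \<Rightarrow> 'a::{field,finite} mat \<Rightarrow> bool"
  where "fat_element m e g \<longleftrightarrow>
    g \<in> carrier (GL m) \<and> real m / 2 < real e \<and> e \<le> m \<and>
    (\<exists>W. gsubmodule (generate (GL m) {g}) (natural_module m) W \<and>
      irreducible_module (generate (GL m) {g}) ((natural_module m)\<lparr>carrier := W\<rparr>) \<and>
      gdim ((natural_module m :: ('a mat, 'a, 'a vec) gmodule)\<lparr>carrier := W\<rparr>) = e)"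

definition fat_pair :: "nat \<Rightarrow> nat \<Rightarrow> nat \<Rightarrow> 'a::{field,finite} mat \<times> 'a mat \<Rightarrow> bool"
  where "fat_pair m e1 e2 p \<longleftrightarrow> fat_element m e1 (fst p) \<and> fat_element m e2 (snd p)"

definition irreducible_pair :: "nat \<Rightarrow> 'a::{field,finite} mat \<times> 'a mat \<Rightarrow> bool"
  where "irreducible_pair m p \<longleftrightarrow>
    irreducible_module (generate (GL m) {fst p, snd p}) (natural_module m)"

end

theory Submission
  imports Defs
begin

text \<open>
  Let \<open>V\<close> be the natural module and let \<open>E\<^sub>1\<close> and \<open>E\<^sub>2\<close> be the irreducible submodules, of dimensions
  \<open>e\<^sub>1\<close> and \<open>e\<^sub>2\<close>, that make \<open>g\<^sub>1\<close> and \<open>g\<^sub>2\<close> fat. Take any composition series of \<open>V\<close> for the group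
  generated by \<open>g\<^sub>1\<close> and \<open>g\<^sub>2\<close>. Each term \<open>W\<close> of the series is stable under \<open>g\<^sub>i\<close>, so \<open>E\<^sub>i \<inter> W\<close> is zero
  or all of \<open>E\<^sub>i\<close>. Consequently \<open>E\<^sub>i\<close> embeds in the factor at which the series first contains it
  (\<open>irreducible_embeds_in_factor\<close>). If the two factors were different, the term just below the
  later one would contain one of the \<open>E\<^sub>i\<close> and meet the other trivially; but \<open>e\<^sub>1 + e\<^sub>2 > d\<close>, so
  \<open>E\<^sub>1 \<inter> E\<^sub>2 \<noteq> 0\<close> (\<open>gdim_add_le\<close>). Hence a single factor \<open>N\<close> receives both. It is irreducible by the
  choice of the series, and since \<open>dim N \<le> d\<close>, the images of \<open>E\<^sub>1\<close> and \<open>E\<^sub>2\<close> show that the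
  induced elements are fat (\<open>fat_element_on_factor\<close>).

  Two reductions let this argument be carried out on the objects in the statement. First, a
  subspace of a finite space is stable under a group of invertible matrices as soon as it is
  stable under a generating set (\<open>gsubmodule_generate_iff\<close>), and irreducibility of subspaces and of
  quotients is a property of the lattice of submodules (\<open>irreducible_restrict_iff\<close>,
  \<open>irreducible_quotient_iff\<close>); so the group generated by \<open>g\<^sub>1\<close> and \<open>g\<^sub>2\<close> and the group generated by
  their induced matrices can both be replaced by their generators. Second, coordinates with respect to a basis of
  \<open>N\<close> are an equivariant isomorphism onto the natural module in which \<open>g\<close> acts by its induced
  matrix (\<open>coordinates_hom\<close>), and all notions involved transfer along such isomorphisms.
\<close>

section \<open>Submodules and equivariant maps\<close>

lemma subspace_iff:
  fixes M :: "('g, 'k::field, 'v) gmodule"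
  assumes "vectorspace class_ring M"
  shows "VectorSpace.subspace class_ring W M \<longleftrightarrow> W \<subseteq> carrier M \<and> \<zero>\<^bsub>M\<^esub> \<in> W \<and>
    (\<forall>v\<in>W. \<forall>w\<in>W. v \<oplus>\<^bsub>M\<^esub> w \<in> W) \<and> (\<forall>c. \<forall>v\<in>W. c \<odot>\<^bsub>M\<^esub> v \<in> W)"
proof -
  have "Module.module class_ring M" using assms by (simp add: VectorSpace.vectorspace_def)
  then show ?thesis
    using assms by (auto simp: VectorSpace.subspace_def LinearCombinations.submodule_def)
qed

lemma subspace_carrier:
  assumes "VectorSpace.subspace class_ring W M"
  shows "W \<subseteq> carrier M"
  using assms by (auto simp: VectorSpace.subspace_def LinearCombinations.submodule_def)

lemma subspace_zero:
  assumes "VectorSpace.subspace class_ring W M"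
  shows "\<zero>\<^bsub>M\<^esub> \<in> W"
  using assms by (auto simp: VectorSpace.subspace_def LinearCombinations.submodule_def)

lemma vectorspace_restrict:
  assumes "VectorSpace.subspace class_ring W M"
  shows "vectorspace class_ring (M\<lparr>carrier := W\<rparr>)"
  using assms vectorspace.subspace_is_vs by (auto simp: VectorSpace.subspace_def)

lemma gsubmodule_iff:
  fixes M :: "('g, 'k::field, 'v) gmodule"
  assumes "vectorspace class_ring M"
  shows "gsubmodule G M W \<longleftrightarrow> W \<subseteq> carrier M \<and> \<zero>\<^bsub>M\<^esub> \<in> W \<and>
    (\<forall>v\<in>W. \<forall>w\<in>W. v \<oplus>\<^bsub>M\<^esub> w \<in> W) \<and> (\<forall>c. \<forall>v\<in>W. c \<odot>\<^bsub>M\<^esub> v \<in> W) \<and>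
    (\<forall>g\<in>G. \<forall>w\<in>W. act M w g \<in> W)"
  by (auto simp: gsubmodule_def subspace_iff[OF assms])

lemma gsubmodule_vectorspace: "gsubmodule G M W \<Longrightarrow> vectorspace class_ring M"
  by (simp add: gsubmodule_def VectorSpace.subspace_def)

lemma gsubmodule_carrier: "gsubmodule G M W \<Longrightarrow> W \<subseteq> carrier M"
  by (simp add: gsubmodule_def subspace_carrier)

lemma gsubmodule_zero: "gsubmodule G M W \<Longrightarrow> \<zero>\<^bsub>M\<^esub> \<in> W"
  by (simp add: gsubmodule_def subspace_zero)

lemma gsubmodule_antimono: "gsubmodule G M W \<Longrightarrow> G' \<subseteq> G \<Longrightarrow> gsubmodule G' M W"
  by (auto simp: gsubmodule_def)

text \<open>A submodule of \<open>M\<lparr>carrier := W\<rparr>\<close> inherits its operations from \<open>M\<close>, so questions about the smaller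
  module become questions about the lattice of submodules of \<open>M\<close>.\<close>

lemma gsubmodule_restrict_iff:
  fixes M :: "('g, 'k::field, 'v) gmodule"
  assumes "VectorSpace.subspace class_ring W M"
  shows "gsubmodule G (M\<lparr>carrier := W\<rparr>) P \<longleftrightarrow> gsubmodule G M P \<and> P \<subseteq> W"
proof -
  have "vectorspace class_ring M" using assms by (simp add: VectorSpace.subspace_def)
  then show ?thesis
    using subspace_carrier[OF assms]
    by (auto simp: gsubmodule_iff vectorspace_restrict[OF assms])
qed

lemma irreducible_restrict_iff:
  fixes M :: "('g, 'k::field, 'v) gmodule"
  assumes "VectorSpace.subspace class_ring W M"
  shows "irreducible_module G (M\<lparr>carrier := W\<rparr>) \<longleftrightarrow>
    W \<noteq> {\<zero>\<^bsub>M\<^esub>} \<and> (\<forall>P. gsubmodule G M P \<longrightarrow> P \<subseteq> W \<longrightarrow> P = {\<zero>\<^bsub>M\<^esub>} \<or> P = W)"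
  using gsubmodule_restrict_iff[OF assms] by (auto simp: irreducible_module_def)

text \<open>A larger group has fewer submodules.\<close>

lemma irreducible_module_mono:
  assumes "irreducible_module G M" "G \<subseteq> G'"
  shows "irreducible_module G' M"
  using assms(1) gsubmodule_antimono[OF _ assms(2)] unfolding irreducible_module_def by blast

text \<open>Equivariant linear maps between modules with different acting elements, which the function \<open>\<sigma>\<close>
  translates: the identity for the projection to a quotient, \<open>induced_matrix N bs\<close> for coordinates.\<close>

definition gmodule_hom where
  "gmodule_hom G \<sigma> M N = {f \<in> LinearCombinations.module_hom class_ring M N.
    \<forall>g\<in>G. \<forall>v\<in>carrier M. f (act M v g) = act N (f v) (\<sigma> g)}"

lemma gmodule_homI:
  fixes M :: "('g, 'k::field, 'v) gmodule" and N :: "('h, 'k, 'w) gmodule"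
  assumes "\<And>v. v \<in> carrier M \<Longrightarrow> f v \<in> carrier N"
    and "\<And>v w. v \<in> carrier M \<Longrightarrow> w \<in> carrier M \<Longrightarrow> f (v \<oplus>\<^bsub>M\<^esub> w) = f v \<oplus>\<^bsub>N\<^esub> f w"
    and "\<And>c v. v \<in> carrier M \<Longrightarrow> f (c \<odot>\<^bsub>M\<^esub> v) = c \<odot>\<^bsub>N\<^esub> f v"
    and "\<And>g v. g \<in> G \<Longrightarrow> v \<in> carrier M \<Longrightarrow> f (act M v g) = act N (f v) (\<sigma> g)"
  shows "f \<in> gmodule_hom G \<sigma> M N"
  using assms by (auto simp: gmodule_hom_def LinearCombinations.module_hom_def)

lemma gmodule_homD:
  fixes M :: "('g, 'k::field, 'v) gmodule" and N :: "('h, 'k, 'w) gmodule"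
  assumes "f \<in> gmodule_hom G \<sigma> M N"
  shows "v \<in> carrier M \<Longrightarrow> f v \<in> carrier N"
    and "v \<in> carrier M \<Longrightarrow> w \<in> carrier M \<Longrightarrow> f (v \<oplus>\<^bsub>M\<^esub> w) = f v \<oplus>\<^bsub>N\<^esub> f w"
    and "v \<in> carrier M \<Longrightarrow> f (c \<odot>\<^bsub>M\<^esub> v) = c \<odot>\<^bsub>N\<^esub> f v"
    and "g \<in> G \<Longrightarrow> v \<in> carrier M \<Longrightarrow> f (act M v g) = act N (f v) (\<sigma> g)"
  using assms by (auto simp: gmodule_hom_def LinearCombinations.module_hom_def)

lemma gmodule_hom_linear_map:
  fixes M :: "('g, 'k::field, 'v) gmodule" and N :: "('h, 'k, 'w) gmodule"
  assumes "vectorspace class_ring M" "vectorspace class_ring N" "f \<in> gmodule_hom G \<sigma> M N"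
  shows "linear_map class_ring M N f"
proof -
  interpret M: vectorspace class_ring M by fact
  interpret N: vectorspace class_ring N by fact
  show ?thesis using assms(3) by unfold_locales (simp add: gmodule_hom_def)
qed

lemma gmodule_hom_zero:
  fixes M :: "('g, 'k::field, 'v) gmodule" and N :: "('h, 'k, 'w) gmodule"
  assumes "vectorspace class_ring M" "vectorspace class_ring N" "f \<in> gmodule_hom G \<sigma> M N"
  shows "f \<zero>\<^bsub>M\<^esub> = \<zero>\<^bsub>N\<^esub>"
  using linear_map.T0_is_0[OF gmodule_hom_linear_map[OF assms]] .

lemma gmodule_hom_inj_iff:
  fixes M :: "('g, 'k::field, 'v) gmodule" and N :: "('h, 'k, 'w) gmodule"
  assumes "vectorspace class_ring M" "vectorspace class_ring N" "f \<in> gmodule_hom G \<sigma> M N"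
  shows "inj_on f (carrier M) \<longleftrightarrow> {v \<in> carrier M. f v = \<zero>\<^bsub>N\<^esub>} = {\<zero>\<^bsub>M\<^esub>}"
proof -
  interpret linear_map class_ring M N f by (rule gmodule_hom_linear_map[OF assms])
  show ?thesis using Ke0_iff_inj by (simp add: ker_def)
qed

lemma gmodule_hom_restrict:
  assumes "f \<in> gmodule_hom G \<sigma> M N" "W \<subseteq> carrier M" "G' \<subseteq> G"
  shows "f \<in> gmodule_hom G' \<sigma> (M\<lparr>carrier := W\<rparr>) N"
  using assms by (auto simp: gmodule_hom_def LinearCombinations.module_hom_def subset_iff)

lemma gmodule_hom_corestrict:
  assumes "f \<in> gmodule_hom G \<sigma> M N" "f ` carrier M \<subseteq> W"
  shows "f \<in> gmodule_hom G \<sigma> M (N\<lparr>carrier := W\<rparr>)"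
  using assms by (auto simp: gmodule_hom_def LinearCombinations.module_hom_def)

lemma gmodule_hom_comp:
  assumes "f \<in> gmodule_hom G \<sigma> M N" "f' \<in> gmodule_hom (\<sigma> ` G) \<tau> N P"
  shows "f' \<circ> f \<in> gmodule_hom G (\<tau> \<circ> \<sigma>) M P"
  using assms by (fastforce simp: gmodule_hom_def LinearCombinations.module_hom_def Pi_iff)

lemma gsubmodule_vimage:
  fixes M :: "('g, 'k::field, 'v) gmodule" and N :: "('h, 'k, 'w) gmodule"
  assumes M: "vectorspace class_ring M" and f: "f \<in> gmodule_hom G \<sigma> M N"
    and stable: "\<And>g v. g \<in> G \<Longrightarrow> v \<in> carrier M \<Longrightarrow> act M v g \<in> carrier M"
    and Y: "gsubmodule (\<sigma> ` G) N Y"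
  shows "gsubmodule G M {v \<in> carrier M. f v \<in> Y}"
proof -
  have N: "vectorspace class_ring N" by (rule gsubmodule_vectorspace[OF Y])
  interpret M: vectorspace class_ring M by fact
  have "c \<odot>\<^bsub>M\<^esub> v \<in> carrier M" if "v \<in> carrier M" for c v using that by simp
  then show ?thesis
    using Y[unfolded gsubmodule_iff[OF N]] gmodule_homD[OF f] gmodule_hom_zero[OF M N f] stable
    by (auto simp: gsubmodule_iff[OF M])
qed

lemma gsubmodule_image:
  fixes M :: "('g, 'k::field, 'v) gmodule" and N :: "('h, 'k, 'w) gmodule"
  assumes N: "vectorspace class_ring N" and f: "f \<in> gmodule_hom G \<sigma> M N"
    and X: "gsubmodule G M X"
  shows "gsubmodule (\<sigma> ` G) N (f ` X)"
proof -
  have M: "vectorspace class_ring M" by (rule gsubmodule_vectorspace[OF X])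
  note X' = X[unfolded gsubmodule_iff[OF M]]
  have Xc: "v \<in> carrier M" if "v \<in> X" for v using that X' by blast
  have 1: "f v \<oplus>\<^bsub>N\<^esub> f w \<in> f ` X" if "v \<in> X" "w \<in> X" for v w
  proof -
    have "f v \<oplus>\<^bsub>N\<^esub> f w = f (v \<oplus>\<^bsub>M\<^esub> w)" using that Xc gmodule_homD(2)[OF f, of v w] by simp
    then show ?thesis using that X' by auto
  qed
  have 2: "c \<odot>\<^bsub>N\<^esub> f v \<in> f ` X" if "v \<in> X" for c v
  proof -
    have "c \<odot>\<^bsub>N\<^esub> f v = f (c \<odot>\<^bsub>M\<^esub> v)" using that Xc gmodule_homD(3)[OF f, of v c] by simp
    then show ?thesis using that X' by auto
  qed
  have 3: "act N (f v) (\<sigma> g) \<in> f ` X" if "v \<in> X" "g \<in> G" for g v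
  proof -
    have "act N (f v) (\<sigma> g) = f (act M v g)" using that Xc gmodule_homD(4)[OF f, of g v] by simp
    then show ?thesis using that X' by auto
  qed
  have 4: "\<zero>\<^bsub>N\<^esub> \<in> f ` X" using gmodule_hom_zero[OF M N f] X' by (metis imageI)
  show ?thesis unfolding gsubmodule_iff[OF N]
    using 1 2 3 4 X' gmodule_homD(1)[OF f] by auto
qed

text \<open>The preimage of a submodule is a submodule, and a bijection can lose none of them.\<close>

lemma irreducible_module_iso:
  fixes M :: "('g, 'k::field, 'v) gmodule" and N :: "('h, 'k, 'w) gmodule"
  assumes M: "vectorspace class_ring M" and N: "vectorspace class_ring N"
    and f: "f \<in> gmodule_hom G \<sigma> M N" and bij: "bij_betw f (carrier M) (carrier N)"
    and stable: "\<And>g v. g \<in> G \<Longrightarrow> v \<in> carrier M \<Longrightarrow> act M v g \<in> carrier M"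
    and irr: "irreducible_module G M"
  shows "irreducible_module (\<sigma> ` G) N"
  unfolding irreducible_module_def
proof (intro conjI allI impI)
  interpret M: vectorspace class_ring M by fact
  have zero: "f \<zero>\<^bsub>M\<^esub> = \<zero>\<^bsub>N\<^esub>" by (rule gmodule_hom_zero[OF M N f])
  show "carrier N \<noteq> {\<zero>\<^bsub>N\<^esub>}"
  proof
    assume *: "carrier N = {\<zero>\<^bsub>N\<^esub>}"
    have "v = \<zero>\<^bsub>M\<^esub>" if "v \<in> carrier M" for v
      using * bij that zero M.zero_closed unfolding bij_betw_def inj_on_def by (metis imageI singletonD)
    then have "carrier M = {\<zero>\<^bsub>M\<^esub>}" using M.zero_closed by auto
    then show False using irr by (simp add: irreducible_module_def)
  qed
  fix Y assume Y: "gsubmodule (\<sigma> ` G) N Y"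
  let ?X = "{v \<in> carrier M. f v \<in> Y}"
  have img: "f ` ?X = Y"
    using gsubmodule_carrier[OF Y] bij unfolding bij_betw_def by auto
  have "?X = {\<zero>\<^bsub>M\<^esub>} \<or> ?X = carrier M"
    using irr gsubmodule_vimage[OF M f stable Y] by (auto simp: irreducible_module_def)
  then show "Y = {\<zero>\<^bsub>N\<^esub>} \<or> Y = carrier N"
  proof
    assume "?X = {\<zero>\<^bsub>M\<^esub>}" then show ?thesis using img zero by auto
  next
    assume "?X = carrier M" then show ?thesis using img bij by (auto simp: bij_betw_def)
  qed
qed

section \<open>Quotients and composition series\<close>

text \<open>Here \<open>G\<close> is a bare set, so that the notion covers a pair of generators as well as the group that
  they generate.\<close>

definition linear_action where
  "linear_action G M \<longleftrightarrow> (\<forall>g\<in>G. (\<lambda>v. act M v g) \<in> LinearCombinations.module_hom class_ring M M)"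

lemma linear_action_closed:
  "linear_action G M \<Longrightarrow> g \<in> G \<Longrightarrow> v \<in> carrier M \<Longrightarrow> act M v g \<in> carrier M"
  by (auto simp: linear_action_def LinearCombinations.module_hom_def)

lemma linear_action_zero:
  fixes M :: "('g, 'k::field, 'v) gmodule"
  assumes M: "vectorspace class_ring M" and "linear_action G M" "g \<in> G"
  shows "act M \<zero>\<^bsub>M\<^esub> g = \<zero>\<^bsub>M\<^esub>"
proof -
  have "(\<lambda>v. act M v g) \<in> gmodule_hom {} id M M"
    using assms by (simp add: linear_action_def gmodule_hom_def)
  then show ?thesis by (rule gmodule_hom_zero[OF M M])
qed

lemma linear_action_restrict:
  assumes "linear_action G M" "gsubmodule G M W"
  shows "linear_action G (M\<lparr>carrier := W\<rparr>)"
  using assms gsubmodule_carrier[OF assms(2)]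
  by (auto simp: linear_action_def gsubmodule_def LinearCombinations.module_hom_def subset_iff)

text \<open>The operations of the quotient are unions over all representatives; the projection turns them
  back into operations on elements, and is the only form in which they are used below.\<close>

lemma quotient_module_hom:
  fixes M :: "('g, 'k::field, 'v) gmodule"
  assumes U: "gsubmodule G M U"
    and lin: "\<And>g. g \<in> G \<Longrightarrow> (\<lambda>v. act M v g) \<in> LinearCombinations.module_hom class_ring M M"
  shows "(\<lambda>x. U +>\<^bsub>M\<^esub> x) \<in> gmodule_hom G id M (quotient_module M U)"
    and "(\<lambda>x. U +>\<^bsub>M\<^esub> x) ` carrier M = carrier (quotient_module M U)"
    and "x \<in> carrier M \<Longrightarrow> U +>\<^bsub>M\<^esub> x = \<zero>\<^bsub>quotient_module M U\<^esub> \<longleftrightarrow> x \<in> U"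
proof -
  note M = gsubmodule_vectorspace[OF U]
  interpret M: vectorspace class_ring M by (rule M)
  note U' = U[unfolded gsubmodule_iff[OF M]]
  have U_neg: "\<ominus>\<^bsub>M\<^esub> u \<in> U" if "u \<in> U" for u
    using that U' M.smult_minus_1[of u]
    by (metis (no_types, lifting) subsetD)
  have "subgroup U (add_monoid M)"
    using U' U_neg by (intro M.add.subgroupI) auto
  then have "additive_subgroup U M"
    by (simp add: additive_subgroup_def)
  then interpret U: abelian_subgroup U M
    by (intro abelian_subgroupI3 M.abelian_group_axioms)
  let ?Q = "quotient_module M U"
  show car: "(\<lambda>x. U +>\<^bsub>M\<^esub> x) ` carrier M = carrier ?Q"
    by (auto simp: quotient_module_def A_RCOSETS_def RCOSETS_def a_r_coset_def)
  \<comment> \<open>Scalars and group elements act on cosets in the same way, through a linear map that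
    preserves \<open>U\<close>.\<close>
  have wd: "(\<Union>y\<in>U +>\<^bsub>M\<^esub> x. U +>\<^bsub>M\<^esub> h y) = U +>\<^bsub>M\<^esub> h x"
    if x: "x \<in> carrier M" and hU: "\<And>u. u \<in> U \<Longrightarrow> h u \<in> U"
      and hM: "\<And>v. v \<in> carrier M \<Longrightarrow> h v \<in> carrier M"
      and hadd: "\<And>v w. v \<in> carrier M \<Longrightarrow> w \<in> carrier M \<Longrightarrow> h (v \<oplus>\<^bsub>M\<^esub> w) = h v \<oplus>\<^bsub>M\<^esub> h w" for h x
  proof -
    have "U +>\<^bsub>M\<^esub> h y = U +>\<^bsub>M\<^esub> h x" if y: "y \<in> U +>\<^bsub>M\<^esub> x" for y
    proof -
      obtain u where u: "u \<in> U" "y = u \<oplus>\<^bsub>M\<^esub> x"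
        using y by (auto simp: a_r_coset_def r_coset_def)
      have uM: "u \<in> carrier M" using u U' by auto
      have "h y = h u \<oplus>\<^bsub>M\<^esub> h x" using u uM x hadd by simp
      with hU[OF u(1)] have "h y \<in> U +>\<^bsub>M\<^esub> h x"
        by (auto simp: a_r_coset_def r_coset_def)
      then show ?thesis using hM[OF x] by (intro U.a_repr_independence'[symmetric]) auto
    qed
    with U.a_rcos_self[OF x] show ?thesis
      by (intro UN_constant_eq ballI)
  qed
  show "(\<lambda>x. U +>\<^bsub>M\<^esub> x) \<in> gmodule_hom G id M ?Q"
  proof (rule gmodule_homI)
    fix c v assume v: "v \<in> carrier M"
    have "(\<Union>y\<in>U +>\<^bsub>M\<^esub> v. U +>\<^bsub>M\<^esub> (c \<odot>\<^bsub>M\<^esub> y)) = U +>\<^bsub>M\<^esub> (c \<odot>\<^bsub>M\<^esub> v)"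
      by (rule wd[OF v]) (use U' in \<open>auto simp: M.smult_r_distr\<close>)
    then show "U +>\<^bsub>M\<^esub> (c \<odot>\<^bsub>M\<^esub> v) = c \<odot>\<^bsub>?Q\<^esub> (U +>\<^bsub>M\<^esub> v)"
      by (simp add: quotient_module_def)
  next
    fix g v assume g: "g \<in> G" and v: "v \<in> carrier M"
    have "(\<Union>y\<in>U +>\<^bsub>M\<^esub> v. U +>\<^bsub>M\<^esub> act M y g) = U +>\<^bsub>M\<^esub> act M v g"
      by (rule wd[OF v]) (use U' g lin[OF g] in \<open>auto simp: LinearCombinations.module_hom_def\<close>)
    then show "U +>\<^bsub>M\<^esub> act M v g = act ?Q (U +>\<^bsub>M\<^esub> v) (id g)"
      by (simp add: quotient_module_def)
  qed (use car in \<open>auto simp: quotient_module_def U.a_rcos_sum\<close>)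
  show "U +>\<^bsub>M\<^esub> x = \<zero>\<^bsub>?Q\<^esub> \<longleftrightarrow> x \<in> U" if x: "x \<in> carrier M"
    using U.a_rcos_self[OF x] U.a_rcos_const[of x] by (auto simp: quotient_module_def)
qed

lemma quotient_module_rep:
  fixes M :: "('g, 'k::field, 'v) gmodule"
  assumes U: "gsubmodule G M U" and x: "x \<in> carrier M" and eq: "U +>\<^bsub>M\<^esub> x = U +>\<^bsub>M\<^esub> y"
  shows "\<exists>u\<in>U. x = u \<oplus>\<^bsub>M\<^esub> y"
proof -
  interpret M: vectorspace class_ring M by (rule gsubmodule_vectorspace[OF U])
  have "\<zero>\<^bsub>M\<^esub> \<oplus>\<^bsub>M\<^esub> x \<in> U +>\<^bsub>M\<^esub> x"
    using gsubmodule_zero[OF U] by (auto simp: a_r_coset_def r_coset_def)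
  then have "x \<in> U +>\<^bsub>M\<^esub> y" using x eq by simp
  then show ?thesis by (auto simp: a_r_coset_def r_coset_def)
qed

lemma linear_action_quotient:
  fixes M :: "('g, 'k::field, 'v) gmodule"
  assumes U: "gsubmodule G M U" and lin: "linear_action G M"
  shows "linear_action G (quotient_module M U)"
  unfolding linear_action_def
proof
  fix g assume g: "g \<in> G"
  interpret M: vectorspace class_ring M by (rule gsubmodule_vectorspace[OF U])
  let ?Q = "quotient_module M U"
  define \<pi> where "\<pi> = (\<lambda>x. U +>\<^bsub>M\<^esub> x)"
  note quot = quotient_module_hom[OF U lin[unfolded linear_action_def, rule_format]]
  have \<pi>: "\<pi> \<in> gmodule_hom G id M ?Q" and img: "\<pi> ` carrier M = carrier ?Q"
    using quot(1,2) by (simp_all add: \<pi>_def)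
  have h: "(\<lambda>v. act M v g) \<in> LinearCombinations.module_hom class_ring M M"
    using lin g by (simp add: linear_action_def)
  have act: "act ?Q (\<pi> x) g = \<pi> (act M x g)" if "x \<in> carrier M" for x
    using gmodule_homD(4)[OF \<pi> g that] by simp
  have s: "c \<odot>\<^bsub>M\<^esub> x \<in> carrier M" if "x \<in> carrier M" for c x using that by simp
  show "(\<lambda>X. act ?Q X g) \<in> LinearCombinations.module_hom class_ring ?Q ?Q"
    unfolding LinearCombinations.module_hom_def
  proof (intro CollectI conjI allI impI funcsetI)
    fix X assume "X \<in> carrier ?Q"
    then obtain x where x: "x \<in> carrier M" "X = \<pi> x" unfolding img[symmetric] by (auto elim!: imageE)
    show "act ?Q X g \<in> carrier ?Q"
      unfolding x(2) act[OF x(1)] by (rule gmodule_homD(1)[OF \<pi> linear_action_closed[OF lin g x(1)]])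
  next
    fix X Y assume "X \<in> carrier ?Q \<and> Y \<in> carrier ?Q"
    then obtain x y where x: "x \<in> carrier M" "X = \<pi> x" and y: "y \<in> carrier M" "Y = \<pi> y"
      unfolding img[symmetric] by (auto elim!: imageE)
    have "X \<oplus>\<^bsub>?Q\<^esub> Y = \<pi> (x \<oplus>\<^bsub>M\<^esub> y)" using gmodule_homD(2)[OF \<pi> x(1) y(1)] x y by simp
    then have "act ?Q (X \<oplus>\<^bsub>?Q\<^esub> Y) g = \<pi> (act M (x \<oplus>\<^bsub>M\<^esub> y) g)" using act x y by simp
    also have "\<dots> = \<pi> (act M x g \<oplus>\<^bsub>M\<^esub> act M y g)"
      using h x y by (simp add: LinearCombinations.module_hom_def)
    also have "\<dots> = act ?Q X g \<oplus>\<^bsub>?Q\<^esub> act ?Q Y g"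
      unfolding x(2) y(2) act[OF x(1)] act[OF y(1)]
      by (rule gmodule_homD(2)[OF \<pi> linear_action_closed[OF lin g x(1)] linear_action_closed[OF lin g y(1)]])
    finally show "act ?Q (X \<oplus>\<^bsub>?Q\<^esub> Y) g = act ?Q X g \<oplus>\<^bsub>?Q\<^esub> act ?Q Y g" .
  next
    fix c :: 'k and X assume "c \<in> carrier class_ring \<and> X \<in> carrier ?Q"
    then obtain x where x: "x \<in> carrier M" "X = \<pi> x" unfolding img[symmetric] by (auto elim!: imageE)
    have "act ?Q (c \<odot>\<^bsub>?Q\<^esub> X) g = \<pi> (act M (c \<odot>\<^bsub>M\<^esub> x) g)"
      unfolding x(2) gmodule_homD(3)[OF \<pi> x(1), symmetric] by (rule act[OF s[OF x(1)]])
    also have "\<dots> = \<pi> (c \<odot>\<^bsub>M\<^esub> act M x g)"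
      using h x by (simp add: LinearCombinations.module_hom_def)
    also have "\<dots> = c \<odot>\<^bsub>?Q\<^esub> act ?Q X g"
      unfolding x(2) act[OF x(1)] by (rule gmodule_homD(3)[OF \<pi> linear_action_closed[OF lin g x(1)]])
    finally show "act ?Q (c \<odot>\<^bsub>?Q\<^esub> X) g = c \<odot>\<^bsub>?Q\<^esub> act ?Q X g" .
  qed
qed

text \<open>The correspondence between submodules of \<open>W / U\<close> and submodules between \<open>U\<close> and \<open>W\<close>. On the
  right-hand side \<open>G\<close> occurs only through its submodules of \<open>M\<close>; this is what allows \<open>G\<close> to be
  exchanged for a generating set.\<close>

lemma irreducible_quotient_iff:
  fixes M :: "('g, 'k::field, 'v) gmodule"
  assumes lin: "linear_action G M" and W: "gsubmodule G M W" and U: "gsubmodule G M U"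
    and UW: "U \<subseteq> W"
  shows "irreducible_module G (quotient_module (M\<lparr>carrier := W\<rparr>) U) \<longleftrightarrow>
    U \<noteq> W \<and> (\<forall>P. gsubmodule G M P \<longrightarrow> U \<subseteq> P \<longrightarrow> P \<subseteq> W \<longrightarrow> P = U \<or> P = W)"
proof -
  let ?W = "M\<lparr>carrier := W\<rparr>"
  let ?Q = "quotient_module ?W U"
  define \<pi> where "\<pi> = (\<lambda>x. U +>\<^bsub>?W\<^esub> x)"
  have sW: "VectorSpace.subspace class_ring W M" using W by (simp add: gsubmodule_def)
  have vW: "vectorspace class_ring ?W" by (rule vectorspace_restrict[OF sW])
  have UW': "gsubmodule G ?W U" by (simp add: gsubmodule_restrict_iff[OF sW] U UW)
  have linW: "linear_action G ?W" by (rule linear_action_restrict[OF lin W])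
  have vQ: "vectorspace class_ring ?Q"
    using UW' by (intro vectorspace_quotient_module) (simp add: gsubmodule_def)
  interpret Q: vectorspace class_ring ?Q by (rule vQ)
  note quot = quotient_module_hom[OF UW' linW[unfolded linear_action_def, rule_format]]
  have \<pi>: "\<pi> \<in> gmodule_hom G id ?W ?Q" "\<pi> ` W = carrier ?Q"
    using quot(1,2) by (simp_all add: \<pi>_def)
  have ker: "\<pi> x = \<zero>\<^bsub>?Q\<^esub> \<longleftrightarrow> x \<in> U" if "x \<in> W" for x
    using quot(3)[of x] that by (simp add: \<pi>_def)
  have "\<pi> u = \<zero>\<^bsub>?Q\<^esub>" if "u \<in> U" for u using that ker[of u] UW by auto
  then have \<pi>U: "\<pi> ` U = {\<zero>\<^bsub>?Q\<^esub>}" using gsubmodule_zero[OF U] by (auto simp: image_iff)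
  show ?thesis
  proof (intro iffI conjI allI impI)
    assume irr: "irreducible_module G ?Q"
    show "U \<noteq> W" using \<pi>U irr \<pi>(2) unfolding irreducible_module_def by metis
    fix P assume P: "gsubmodule G M P" "U \<subseteq> P" "P \<subseteq> W"
    then have PW: "gsubmodule G ?W P" by (simp add: gsubmodule_restrict_iff[OF sW])
    have "gsubmodule (id ` G) ?Q (\<pi> ` P)" by (rule gsubmodule_image[OF vQ \<pi>(1) PW])
    then have "\<pi> ` P = {\<zero>\<^bsub>?Q\<^esub>} \<or> \<pi> ` P = carrier ?Q"
      using irr by (simp add: irreducible_module_def)
    then show "P = U \<or> P = W"
    proof
      assume "\<pi> ` P = {\<zero>\<^bsub>?Q\<^esub>}"
      then have "\<pi> x = \<zero>\<^bsub>?Q\<^esub>" if "x \<in> P" for x using that by (metis imageI singletonD)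
      then have "P \<subseteq> U" using ker P(3) by (metis subset_iff)
      then show ?thesis using P by blast
    next
      assume full: "\<pi> ` P = carrier ?Q"
      have "W \<subseteq> P"
      proof
        fix w assume w: "w \<in> W"
        then have "\<pi> w \<in> \<pi> ` P" using full \<pi>(2) by (metis imageI)
        then obtain p where p: "p \<in> P" "\<pi> w = \<pi> p" by (rule imageE)
        then obtain u where "u \<in> U" "w = u \<oplus>\<^bsub>?W\<^esub> p"
          using quotient_module_rep[OF UW', of w p] w by (auto simp: \<pi>_def)
        then show "w \<in> P"
          using p(1) P(1,2) unfolding gsubmodule_iff[OF gsubmodule_vectorspace[OF U]] by auto
      qed
      then show ?thesis using P by blast
    qed
  next
    assume max: "U \<noteq> W \<and> (\<forall>P. gsubmodule G M P \<longrightarrow> U \<subseteq> P \<longrightarrow> P \<subseteq> W \<longrightarrow> P = U \<or> P = W)"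
    show "irreducible_module G ?Q"
      unfolding irreducible_module_def
    proof (intro conjI allI impI)
      obtain w where w: "w \<in> W" "w \<notin> U" using max UW by blast
      then have "\<pi> w \<in> carrier ?Q" "\<pi> w \<noteq> \<zero>\<^bsub>?Q\<^esub>" using ker[OF w(1)] \<pi>(2) imageI[of w W \<pi>] by simp_all
      then show "carrier ?Q \<noteq> {\<zero>\<^bsub>?Q\<^esub>}" by (metis singletonD)
      fix X assume X: "gsubmodule G ?Q X"
      let ?P = "{w \<in> W. \<pi> w \<in> X}"
      have "gsubmodule G ?W {w \<in> carrier ?W. \<pi> w \<in> X}"
        using X linear_action_closed[OF linW] by (intro gsubmodule_vimage[OF vW \<pi>(1)]) auto
      then have P: "gsubmodule G M ?P" using gsubmodule_restrict_iff[OF sW] by simp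
      have "u \<in> ?P" if "u \<in> U" for u
        using that ker[of u] UW gsubmodule_zero[OF X] by auto
      then have "U \<subseteq> ?P" by (rule subsetI)
      moreover have "?P \<subseteq> W" by (rule Collect_restrict)
      ultimately have "?P = U \<or> ?P = W" using max P by simp
      moreover have "\<pi> ` ?P = X"
      proof (intro equalityI subsetI)
        fix x assume "x \<in> X"
        then have "x \<in> \<pi> ` W" using gsubmodule_carrier[OF X] \<pi>(2) by (metis subsetD)
        then show "x \<in> \<pi> ` ?P" using \<open>x \<in> X\<close> by (auto elim!: imageE)
      qed (auto elim!: imageE)
      moreover have "\<pi> ` U = {\<zero>\<^bsub>?Q\<^esub>}" by (rule \<pi>U)
      ultimately show "X = {\<zero>\<^bsub>?Q\<^esub>} \<or> X = carrier ?Q" using \<pi>(2) by metis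
    qed
  qed
qed

text \<open>Below a nonzero submodule \<open>W\<close> lies a maximal proper submodule \<open>U\<close>, and \<open>W\<close> can be appended to a
  series for \<open>U\<close>.\<close>

lemma composition_series_exists_restrict:
  fixes M :: "('g, 'k::field, 'v) gmodule"
  assumes fin: "finite (carrier M)" and lin: "linear_action G M" and W: "gsubmodule G M W"
  shows "\<exists>Ws. composition_series G (M\<lparr>carrier := W\<rparr>) Ws"
  using W
proof (induction "card W" arbitrary: W rule: less_induct)
  case less
  note W = less.prems
  have vM: "vectorspace class_ring M" by (rule gsubmodule_vectorspace[OF W])
  interpret M: vectorspace class_ring M by (rule vM)
  have finW: "finite W" using gsubmodule_carrier[OF W] fin by (rule finite_subset)
  have sW: "VectorSpace.subspace class_ring W M" using W by (simp add: gsubmodule_def)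
  show ?case
  proof (cases "W = {\<zero>\<^bsub>M\<^esub>}")
    case True
    have "gsubmodule G (M\<lparr>carrier := W\<rparr>) W" by (simp add: gsubmodule_restrict_iff[OF sW] W)
    with True have "composition_series G (M\<lparr>carrier := W\<rparr>) [W]"
      by (simp add: composition_series_def)
    then show ?thesis by blast
  next
    case False
    let ?A = "{P. gsubmodule G M P \<and> P \<subset> W}"
    have "gsubmodule G M {\<zero>\<^bsub>M\<^esub>}"
      using linear_action_zero[OF vM lin] by (auto simp: gsubmodule_iff[OF vM])
    then have "{\<zero>\<^bsub>M\<^esub>} \<in> ?A" using False gsubmodule_zero[OF W] by auto
    moreover have "finite ?A" using finW by (rule finite_subset[rotated, OF finite_Pow_iff[THEN iffD2]]) auto
    ultimately obtain U where U: "U \<in> ?A" and max: "\<And>P. P \<in> ?A \<Longrightarrow> U \<subseteq> P \<Longrightarrow> U = P"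
      using finite_has_maximal[of ?A] by (metis (no_types, lifting) empty_iff)
    have U': "gsubmodule G M U" "U \<subseteq> W" "U \<noteq> W" using U by auto
    have sU: "VectorSpace.subspace class_ring U M" using U' by (simp add: gsubmodule_def)
    obtain Ws where Ws: "composition_series G (M\<lparr>carrier := U\<rparr>) Ws"
      using less.hyps[of U] psubset_card_mono[OF finW, of U] U by auto
    have irr: "irreducible_module G (quotient_module (M\<lparr>carrier := W\<rparr>) U)"
      unfolding irreducible_quotient_iff[OF lin W U'(1,2)] using U' max by blast
    have last: "Ws ! (length Ws - Suc 0) = U" and ne: "Ws \<noteq> []"
      using Ws by (auto simp: composition_series_def last_conv_nth)
    have "composition_series G (M\<lparr>carrier := W\<rparr>) (Ws @ [W])"
      unfolding composition_series_def
    proof (intro conjI ballI allI impI)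
      fix X assume "X \<in> set (Ws @ [W])"
      then show "gsubmodule G (M\<lparr>carrier := W\<rparr>) X"
        using Ws U' W by (auto simp: composition_series_def gsubmodule_restrict_iff[OF sW]
          gsubmodule_restrict_iff[OF sU])
    next
      fix i assume i: "Suc i < length (Ws @ [W])"
      show "(Ws @ [W]) ! i \<subseteq> (Ws @ [W]) ! Suc i"
      proof (cases "Suc i < length Ws")
        case True then show ?thesis using Ws by (simp add: composition_series_def nth_append)
      next
        case False
        then have "length Ws = Suc i" using i by simp
        then show ?thesis using U'(2) last by (simp add: nth_append)
      qed
      show "irreducible_module G (quotient_module (M\<lparr>carrier := W, carrier := (Ws @ [W]) ! Suc i\<rparr>)
          ((Ws @ [W]) ! i))"
      proof (cases "Suc i < length Ws")
        case True then show ?thesis using Ws by (simp add: composition_series_def nth_append)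
      next
        case False
        then have "length Ws = Suc i" using i by simp
        then show ?thesis using irr last by (simp add: nth_append)
      qed
    qed (use Ws in \<open>auto simp: composition_series_def\<close>)
    then show ?thesis by blast
  qed
qed

lemma composition_series_exists:
  fixes M :: "('g, 'k::field, 'v) gmodule"
  assumes "vectorspace class_ring M" "finite (carrier M)" "linear_action G M"
  shows "\<exists>Ws. composition_series G M Ws"
proof -
  interpret M: vectorspace class_ring M by fact
  have "gsubmodule G M (carrier M)"
    using linear_action_closed[OF assms(3)] M.smult_closed
    by (auto simp: gsubmodule_iff[OF assms(1)])
  then show ?thesis
    using composition_series_exists_restrict[OF assms(2,3), of "carrier M"] by simp
qed

lemma composition_series_mono:
  assumes "composition_series G M Ws" "i \<le> j" "j < length Ws"
  shows "Ws ! i \<subseteq> Ws ! j"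
  using assms(2,3)
proof (induction rule: dec_induct)
  case (step k)
  then have "Ws ! k \<subseteq> Ws ! Suc k" using assms(1) by (simp add: composition_series_def)
  then show ?case using step by auto
qed simp

text \<open>Each term of the series is stable under \<open>H\<close>, so it either contains the irreducible \<open>E\<close> or meets
  it trivially. At the step where the terms begin to contain \<open>E\<close>, the module \<open>E\<close> embeds in the
  factor.\<close>

lemma irreducible_embeds_in_factor:
  fixes M :: "('g, 'k::field, 'v) gmodule"
  assumes series: "composition_series G M Ws" and H: "H \<subseteq> G"
    and E: "gsubmodule H M E" and irr: "irreducible_module H (M\<lparr>carrier := E\<rparr>)"
  shows "\<exists>i. Suc i < length Ws \<and> E \<subseteq> Ws ! Suc i \<and> E \<inter> Ws ! i = {\<zero>\<^bsub>M\<^esub>}"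
proof -
  have M: "vectorspace class_ring M" by (rule gsubmodule_vectorspace[OF E])
  have sE: "VectorSpace.subspace class_ring E M" using E by (simp add: gsubmodule_def)
  note irr' = irr[unfolded irreducible_restrict_iff[OF sE]]
  have ne: "Ws \<noteq> []" using series by (simp add: composition_series_def)
  \<comment> \<open>The position at which the series first contains \<open>E\<close>.\<close>
  define k where "k = (LEAST k. k < length Ws \<and> E \<subseteq> Ws ! k)"
  have "E \<subseteq> Ws ! (length Ws - 1)"
    using series gsubmodule_carrier[OF E] ne by (simp add: composition_series_def last_conv_nth)
  then have k: "k < length Ws" "E \<subseteq> Ws ! k"
    using LeastI[of "\<lambda>k. k < length Ws \<and> E \<subseteq> Ws ! k" "length Ws - 1"] ne by (simp_all add: k_def)
  have "Ws ! 0 = {\<zero>\<^bsub>M\<^esub>}" using series ne by (simp add: composition_series_def hd_conv_nth)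
  then have "k \<noteq> 0" using k irr' gsubmodule_zero[OF E] by fastforce
  then obtain i where i: "k = Suc i" by (cases k) auto
  have nsub: "\<not> E \<subseteq> Ws ! i"
    using not_less_Least[of i "\<lambda>k. k < length Ws \<and> E \<subseteq> Ws ! k"] k i by (simp add: k_def)
  have "gsubmodule G M (Ws ! i)" using series k i by (simp add: composition_series_def)
  then have "gsubmodule H M (Ws ! i)" using H by (rule gsubmodule_antimono)
  then have "gsubmodule H M (E \<inter> Ws ! i)"
    using E unfolding gsubmodule_iff[OF M] by blast
  then have "E \<inter> Ws ! i = {\<zero>\<^bsub>M\<^esub>} \<or> E \<inter> Ws ! i = E" using irr' by simp
  then show ?thesis using nsub k i by blast
qed

section \<open>The natural module of the general linear group\<close>

lemma natural_module_simps [simp]: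
  "carrier (natural_module m) = carrier_vec m"
  "\<zero>\<^bsub>natural_module m\<^esub> = 0\<^sub>v m"
  "v \<oplus>\<^bsub>natural_module m\<^esub> w = v + w"
  "c \<odot>\<^bsub>natural_module m\<^esub> v = c \<cdot>\<^sub>v v"
  "act (natural_module m) v g = transpose_mat g *\<^sub>v v"
  by (auto simp: natural_module_def module.defs module_vec_def)

lemma linear_action_natural_module:
  assumes "S \<subseteq> carrier_mat m m"
  shows "linear_action S (natural_module m :: ('a mat, 'a::field, 'a vec) gmodule)"
  unfolding linear_action_def
proof
  fix g assume "g \<in> S"
  then have "g \<in> carrier_mat m m" using assms by blast
  then show "(\<lambda>v. act (natural_module m) v g) \<in>
      LinearCombinations.module_hom class_ring (natural_module m) (natural_module m)"
    by (auto simp: LinearCombinations.module_hom_def mult_add_distrib_mat_vec[of _ m m]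
        mult_mat_vec[of _ m m])
qed

lemma bij_betw_carrier_vec_lists:
  "bij_betw list_of_vec (carrier_vec m) {xs :: 'a list. set xs \<subseteq> UNIV \<and> length xs = m}"
proof (rule bij_betw_byWitness[where f' = vec_of_list])
  show "vec_of_list ` {xs :: 'a list. set xs \<subseteq> UNIV \<and> length xs = m} \<subseteq> carrier_vec m"
    by (intro image_subsetI carrier_vecI) simp
qed (simp_all add: vec_list list_vec image_subset_iff)

lemma finite_carrier_vec: "finite (carrier_vec m :: 'a::finite vec set)"
proof -
  have "finite {xs :: 'a list. set xs \<subseteq> UNIV \<and> length xs = m}"
    by (rule finite_lists_length_eq) simp
  then show ?thesis unfolding bij_betw_finite[OF bij_betw_carrier_vec_lists] .
qed

lemma GL_group: "group (GL m :: 'a::field mat monoid)"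
proof -
  interpret ring "ring_mat TYPE('a) m ()" by (rule ring_mat)
  show ?thesis unfolding GL_def by (rule units_group)
qed

lemma GL_carrier: "carrier (GL m :: 'a::field mat monoid) \<subseteq> carrier_mat m m"
  unfolding GL_def units_of_carrier Units_def ring_mat_simps(5) by blast

lemma GL_simps:
  "g \<otimes>\<^bsub>GL m\<^esub> h = g * h" "\<one>\<^bsub>GL m\<^esub> = 1\<^sub>m m"
  by (simp_all add: GL_def units_of_def ring_mat_simps)

lemma act_one: "v \<in> carrier_vec m \<Longrightarrow> act (natural_module m) v (\<one>\<^bsub>GL m\<^esub>) = v"
  by (simp add: GL_simps)

lemma act_mult:
  fixes g h :: "'a::field mat"
  assumes "g \<in> carrier (GL m)" "h \<in> carrier (GL m)" "v \<in> carrier_vec m"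
  shows "act (natural_module m) v (g \<otimes>\<^bsub>GL m\<^esub> h) = act (natural_module m) (act (natural_module m) v g) h"
proof -
  have "g \<in> carrier_mat m m" "h \<in> carrier_mat m m" using assms GL_carrier by auto
  then show ?thesis using assms(3)
    by (simp add: GL_simps transpose_mult[of _ m m _ m] assoc_mult_mat_vec[of _ m m _ m])
qed

lemma inj_on_act_GL:
  fixes g :: "'a::field mat"
  assumes g: "g \<in> carrier (GL m)"
  shows "inj_on (\<lambda>v. act (natural_module m) v g) (carrier_vec m)"
proof (rule inj_on_inverseI)
  interpret G: group "GL m :: 'a mat monoid" by (rule GL_group)
  fix v :: "'a vec" assume v: "v \<in> carrier_vec m"
  show "act (natural_module m) (act (natural_module m) v g) (inv\<^bsub>GL m\<^esub> g) = v"
    unfolding act_mult[OF g G.inv_closed[OF g] v, symmetric] using g v by (simp only: G.r_inv act_one)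
qed

lemma GL_memI:
  fixes A :: "'a::field mat"
  assumes A: "A \<in> carrier_mat m m"
    and ker: "\<And>v. v \<in> carrier_vec m \<Longrightarrow> act (natural_module m) v A = 0\<^sub>v m \<Longrightarrow> v = 0\<^sub>v m"
  shows "A \<in> carrier (GL m)"
proof -
  have "det (transpose_mat A) \<noteq> 0"
    using det_0_iff_vec_prod_zero_field[of "transpose_mat A" m] A ker by auto
  then have "det A \<noteq> 0" by (simp add: det_transpose[OF A])
  then show ?thesis
    unfolding GL_def units_of_carrier by (rule det_non_zero_imp_unit[OF A])
qed

text \<open>Only closure under inverses needs an argument: an invertible \<open>h\<close> maps a stable subspace \<open>W\<close>
  injectively into itself, hence onto itself because \<open>W\<close> is finite, so \<open>h\<inverse>\<close> preserves \<open>W\<close> too.\<close>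

lemma gsubmodule_generate_iff:
  fixes S :: "'a::{field,finite} mat set"
  assumes S: "S \<subseteq> carrier (GL m)"
  shows "gsubmodule (generate (GL m) S) (natural_module m) W \<longleftrightarrow> gsubmodule S (natural_module m) W"
proof
  assume "gsubmodule (generate (GL m) S) (natural_module m) W"
  then show "gsubmodule S (natural_module m) W"
    by (rule gsubmodule_antimono) (auto intro: generate.incl)
next
  let ?V = "natural_module m :: ('a mat, 'a, 'a vec) gmodule"
  interpret G: group "GL m :: 'a mat monoid" by (rule GL_group)
  assume W: "gsubmodule S ?V W"
  have Wc: "W \<subseteq> carrier_vec m" using gsubmodule_carrier[OF W] by simp
  have finW: "finite W" using Wc finite_carrier_vec by (rule finite_subset)
  have "\<forall>w\<in>W. act ?V w h \<in> W" if "h \<in> generate (GL m) S" for h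
    using that
  proof (induction rule: generate.induct)
    case one show ?case
    proof
      fix w assume w: "w \<in> W"
      then show "act ?V w \<one>\<^bsub>GL m\<^esub> \<in> W" using act_one[OF subsetD[OF Wc w]] by (simp only:)
    qed
  next
    case (incl h) then show ?case using W unfolding gsubmodule_def by blast
  next
    case (inv h)
    have h: "h \<in> carrier (GL m)" using inv S by auto
    have "(\<lambda>w. act ?V w h) ` W \<subseteq> W" using W inv unfolding gsubmodule_def by blast
    then have surj: "(\<lambda>w. act ?V w h) ` W = W"
      by (rule endo_inj_surj[OF finW _ inj_on_subset[OF inj_on_act_GL[OF h] Wc]])
    show ?case
    proof
      fix w assume "w \<in> W"
      then obtain w' where w': "w' \<in> W" "w = act ?V w' h" using surj by blast
      have "act ?V w (inv\<^bsub>GL m\<^esub> h) = act ?V w' (h \<otimes>\<^bsub>GL m\<^esub> inv\<^bsub>GL m\<^esub> h)"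
        unfolding w'(2) by (rule act_mult[symmetric, OF h G.inv_closed[OF h] subsetD[OF Wc w'(1)]])
      also have "\<dots> = w'"
        using act_one[OF subsetD[OF Wc w'(1)]] by (simp only: G.r_inv[OF h])
      finally show "act ?V w (inv\<^bsub>GL m\<^esub> h) \<in> W" using w'(1) by (simp only:)
    qed
  next
    case (eng h1 h2)
    show ?case
    proof
      fix w assume w: "w \<in> W"
      have "act ?V w (h1 \<otimes>\<^bsub>GL m\<^esub> h2) = act ?V (act ?V w h1) h2"
        by (rule act_mult[OF G.generate_in_carrier[OF S eng.hyps(1)]
            G.generate_in_carrier[OF S eng.hyps(2)] subsetD[OF Wc w]])
      moreover have "act ?V (act ?V w h1) h2 \<in> W" using eng.IH w by blast
      ultimately show "act ?V w (h1 \<otimes>\<^bsub>GL m\<^esub> h2) \<in> W" by (simp only:)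
    qed
  qed
  then show "gsubmodule (generate (GL m) S) ?V W"
    using W unfolding gsubmodule_def by blast
qed

section \<open>Coordinates and induced matrices\<close>

lemma module_hom_finsum:
  fixes M :: "('g, 'k::field, 'v) gmodule" and N :: "('h, 'k, 'w) gmodule"
  assumes M: "vectorspace class_ring M" and N: "vectorspace class_ring N"
    and f: "f \<in> LinearCombinations.module_hom class_ring M N"
    and fin: "finite I" and x: "\<And>i. i \<in> I \<Longrightarrow> x i \<in> carrier M"
  shows "f (\<Oplus>\<^bsub>M\<^esub>i\<in>I. x i) = (\<Oplus>\<^bsub>N\<^esub>i\<in>I. f (x i))"
proof -
  interpret M: vectorspace class_ring M by fact
  interpret N: vectorspace class_ring N by fact
  have f': "f \<in> gmodule_hom {} (\<lambda>_. undefined) M N" using f by (simp add: gmodule_hom_def)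
  show ?thesis
    using fin x
  proof (induction I)
    case empty then show ?case using gmodule_hom_zero[OF M N f'] by simp
  next
    case (insert i I)
    have "(\<Oplus>\<^bsub>M\<^esub>i\<in>I. x i) \<in> carrier M" using insert by (intro M.finsum_closed) auto
    then have "f (x i \<oplus>\<^bsub>M\<^esub> (\<Oplus>\<^bsub>M\<^esub>i\<in>I. x i)) = f (x i) \<oplus>\<^bsub>N\<^esub> (\<Oplus>\<^bsub>N\<^esub>i\<in>I. f (x i))"
      using insert gmodule_homD(2)[OF f', of "x i" "\<Oplus>\<^bsub>M\<^esub>i\<in>I. x i"] by simp
    then show ?case
      using insert gmodule_homD(1)[OF f'] by (subst M.finsum_insert N.finsum_insert; auto)+
  qed
qed

lemma ordered_basis_exists:
  fixes M :: "('g, 'k::field, 'v) gmodule"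
  assumes "vectorspace class_ring M" and fin: "finite (carrier M)"
  shows "\<exists>bs. ordered_basis M bs"
proof -
  interpret M: vectorspace class_ring M by fact
  have "M.span (carrier M) = carrier M"
    by (meson M.in_own_span M.span_is_subset2 order_refl subset_antisym)
  with fin have "M.fin_dim"
    unfolding M.fin_dim_def by blast
  then obtain B where B: "finite B" "M.basis B"
    using M.finite_basis_exists by blast
  obtain bs where "set bs = B" "distinct bs"
    using finite_distinct_list[OF B(1)] by blast
  with B show ?thesis by (auto simp: ordered_basis_def)
qed

lemma length_ordered_basis:
  fixes M :: "('g, 'k::field, 'v) gmodule"
  assumes "vectorspace class_ring M" "ordered_basis M bs"
  shows "length bs = gdim M"
  using assms vectorspace.dim_basis[OF assms(1), of "set bs"]
  by (simp add: ordered_basis_def distinct_card)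

lemma ordered_basis_carrier:
  fixes M :: "('g, 'k::field, 'v) gmodule"
  assumes "vectorspace class_ring M" "ordered_basis M bs"
  shows "set bs \<subseteq> carrier M"
  using assms vectorspace.basis_def[OF assms(1), of "set bs"]
  by (simp add: ordered_basis_def)

definition basis_combination where
  "basis_combination M bs v = (\<Oplus>\<^bsub>M\<^esub>j\<in>{..<length bs}. (v $ j) \<odot>\<^bsub>M\<^esub> bs ! j)"

lemma basis_combination_linear:
  fixes M :: "('g, 'k::field, 'v) gmodule"
  assumes M: "vectorspace class_ring M" and bs: "set bs \<subseteq> carrier M" and n: "n = length bs"
  shows "basis_combination M bs v \<in> carrier M"
    and "v \<in> carrier_vec n \<Longrightarrow> w \<in> carrier_vec n \<Longrightarrow>
      basis_combination M bs (v + w) = basis_combination M bs v \<oplus>\<^bsub>M\<^esub> basis_combination M bs w"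
    and "v \<in> carrier_vec n \<Longrightarrow>
      basis_combination M bs (c \<cdot>\<^sub>v v) = c \<odot>\<^bsub>M\<^esub> basis_combination M bs v"
proof -
  interpret M: vectorspace class_ring M by fact
  have b: "bs ! j \<in> carrier M" if "j < length bs" for j using bs that by auto
  have s: "c \<odot>\<^bsub>M\<^esub> x \<in> carrier M" if "x \<in> carrier M" for c x using that by simp
  show "basis_combination M bs v \<in> carrier M"
    unfolding basis_combination_def by (intro M.finsum_closed) (auto simp: b s)
  show "basis_combination M bs (v + w) = basis_combination M bs v \<oplus>\<^bsub>M\<^esub> basis_combination M bs w"
    if "v \<in> carrier_vec n" "w \<in> carrier_vec n"
  proof -
    have "basis_combination M bs (v + w) =
        (\<Oplus>\<^bsub>M\<^esub>j\<in>{..<length bs}. (v $ j) \<odot>\<^bsub>M\<^esub> bs ! j \<oplus>\<^bsub>M\<^esub> (w $ j) \<odot>\<^bsub>M\<^esub> bs ! j)"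
      unfolding basis_combination_def
      by (rule M.finsum_cong') (use that b s n M.smult_l_distr in auto)
    also have "\<dots> = basis_combination M bs v \<oplus>\<^bsub>M\<^esub> basis_combination M bs w"
      unfolding basis_combination_def by (rule M.finsum_addf) (auto simp: b s)
    finally show ?thesis .
  qed
  show "basis_combination M bs (c \<cdot>\<^sub>v v) = c \<odot>\<^bsub>M\<^esub> basis_combination M bs v"
    if "v \<in> carrier_vec n"
  proof -
    have "basis_combination M bs (c \<cdot>\<^sub>v v) =
        (\<Oplus>\<^bsub>M\<^esub>j\<in>{..<length bs}. c \<odot>\<^bsub>M\<^esub> ((v $ j) \<odot>\<^bsub>M\<^esub> bs ! j))"
      unfolding basis_combination_def
      by (rule M.finsum_cong') (use that b s n M.smult_assoc1 in auto)
    also have "\<dots> = c \<odot>\<^bsub>M\<^esub> basis_combination M bs v"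
      unfolding basis_combination_def by (rule M.finsum_smult_ldistr[symmetric]) (auto simp: b s)
    finally show ?thesis .
  qed
qed

text \<open>Linear combinations in the vector space library have coefficients indexed by the basis
  vectors; here they are transported to positions in the list of basis vectors.\<close>

lemma bij_betw_basis_combination:
  fixes M :: "('g, 'k::field, 'v) gmodule"
  assumes M: "vectorspace class_ring M" and bs: "ordered_basis M bs" and n: "n = length bs"
  shows "bij_betw (basis_combination M bs) (carrier_vec n) (carrier M)"
proof -
  interpret M: vectorspace class_ring M by fact
  have bsc: "set bs \<subseteq> carrier M" by (rule ordered_basis_carrier[OF M bs])
  have dist: "distinct bs" using bs by (simp add: ordered_basis_def)
  have inj: "inj_on ((!) bs) {..<length bs}"
    using dist by (auto simp: inj_on_def nth_eq_iff_index_eq)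
  have img: "(!) bs ` {..<length bs} = set bs"
    by (auto simp: set_conv_nth)
  have s: "c \<odot>\<^bsub>M\<^esub> x \<in> carrier M" if "x \<in> carrier M" for c x using that by simp
  have comb: "M.lincomb a (set bs) = basis_combination M bs v"
    if "\<And>j. j < length bs \<Longrightarrow> a (bs ! j) = v $ j" for a v
  proof -
    have "M.lincomb a (set bs) = (\<Oplus>\<^bsub>M\<^esub>j\<in>{..<length bs}. a (bs ! j) \<odot>\<^bsub>M\<^esub> bs ! j)"
    proof -
      have "(\<lambda>x. a x \<odot>\<^bsub>M\<^esub> x) \<in> (!) bs ` {..<length bs} \<rightarrow> carrier M"
        unfolding img using bsc s by blast
      from M.finsum_reindex[OF this inj] show ?thesis
        unfolding M.lincomb_def img .
    qed
    also have "\<dots> = basis_combination M bs v"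
      unfolding basis_combination_def
      by (rule M.finsum_cong') (use that s subsetD[OF bsc nth_mem] in auto)
    finally show ?thesis .
  qed
  have uniq: "\<exists>!a. a \<in> set bs \<rightarrow>\<^sub>E UNIV \<and> M.lincomb a (set bs) = x" if "x \<in> carrier M" for x
    using M.basis_criterion[of "set bs"] bs bsc that by (simp add: ordered_basis_def)
  \<comment> \<open>The coefficient function on the set of basis vectors that belongs to a coordinate vector; it is
    restricted to that set because uniqueness of coefficients is stated for extensional functions.\<close>
  define co where "co v = restrict (\<lambda>b. v $ the_inv_into {..<length bs} ((!) bs) b) (set bs)"
    for v :: "'k vec"
  have co: "co v (bs ! j) = v $ j" if "j < length bs" for v j
    using that by (simp add: co_def the_inv_into_f_f[OF inj])
  have coE: "co v \<in> set bs \<rightarrow>\<^sub>E UNIV" for v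
    by (auto simp: co_def)
  show ?thesis
    unfolding bij_betw_def
  proof (intro conjI equalityI subsetI inj_onI)
    fix v w :: "'k vec" assume v: "v \<in> carrier_vec n" and w: "w \<in> carrier_vec n"
      and eq: "basis_combination M bs v = basis_combination M bs w"
    have "M.lincomb (co v) (set bs) = basis_combination M bs v" by (rule comb[OF co])
    moreover have "M.lincomb (co w) (set bs) = basis_combination M bs v"
      unfolding eq by (rule comb[OF co])
    ultimately have "co v = co w"
      using coE uniq[OF basis_combination_linear(1)[OF M bsc n, of v]] by blast
    then have "v $ j = w $ j" if "j < n" for j
      using co[of j v] co[of j w] that n by simp
    then show "v = w" using v w by (intro eq_vecI) auto
  next
    fix x assume "x \<in> basis_combination M bs ` carrier_vec n"
    then show "x \<in> carrier M" using basis_combination_linear(1)[OF M bsc n] by blast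
  next
    fix x assume "x \<in> carrier M"
    then obtain a where a: "M.lincomb a (set bs) = x" using uniq by blast
    have "x = basis_combination M bs (vec n (\<lambda>j. a (bs ! j)))"
      unfolding a[symmetric] by (rule comb) (simp add: n)
    then show "x \<in> basis_combination M bs ` carrier_vec n"
      by (metis imageI vec_carrier)
  qed
qed

definition coordinates where
  "coordinates M bs = inv_into (carrier_vec (length bs)) (basis_combination M bs)"

lemma coordinates:
  fixes M :: "('g, 'k::field, 'v) gmodule"
  assumes M: "vectorspace class_ring M" and bs: "ordered_basis M bs" and n: "n = length bs"
  shows "bij_betw (coordinates M bs) (carrier M) (carrier_vec n)"
    and "x \<in> carrier M \<Longrightarrow> basis_combination M bs (coordinates M bs x) = x"
    and "v \<in> carrier_vec n \<Longrightarrow> coordinates M bs (basis_combination M bs v) = v"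
    and "x \<in> carrier M \<Longrightarrow> coordinates M bs x \<in> carrier_vec n"
proof -
  note bij = bij_betw_basis_combination[OF M bs n]
  show b: "bij_betw (coordinates M bs) (carrier M) (carrier_vec n)"
    unfolding coordinates_def n[symmetric] by (rule bij_betw_inv_into[OF bij])
  show "x \<in> carrier M \<Longrightarrow> basis_combination M bs (coordinates M bs x) = x"
    unfolding coordinates_def n[symmetric] by (rule bij_betw_inv_into_right[OF bij])
  show "v \<in> carrier_vec n \<Longrightarrow> coordinates M bs (basis_combination M bs v) = v"
    unfolding coordinates_def n[symmetric] by (rule bij_betw_inv_into_left[OF bij])
  show "x \<in> carrier M \<Longrightarrow> coordinates M bs x \<in> carrier_vec n"
    using b by (rule bij_betw_apply)
qed

lemma index_finsum_natural_module:
  fixes f :: "'i \<Rightarrow> 'a::field vec"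
  assumes "finite I" "\<And>i. i \<in> I \<Longrightarrow> f i \<in> carrier_vec n" "j < n"
  shows "(\<Oplus>\<^bsub>natural_module n\<^esub>i\<in>I. f i) $ j = (\<Sum>i\<in>I. f i $ j)"
proof -
  let ?N = "natural_module n :: ('a mat, 'a, 'a vec) gmodule"
  interpret N: vectorspace class_ring ?N by (rule vectorspace_natural_module)
  show ?thesis
    using assms(1,2)
  proof (induction I)
    case empty then show ?case using assms(3) N.finsum_empty[of f] by simp
  next
    case (insert i I)
    have "finsum ?N f (insert i I) = f i + finsum ?N f I"
      using N.finsum_insert[of I i f] insert by auto
    moreover have "finsum ?N f I \<in> carrier_vec n"
      using N.finsum_closed[of f I] insert by auto
    ultimately show ?case using insert assms(3) by simp
  qed
qed

text \<open>Existence and uniqueness of the matrix in the definite description: its rows are forced to be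
  coordinate vectors.\<close>

lemma induced_matrix_props:
  fixes M :: "('g, 'k::field, 'v) gmodule"
  assumes M: "vectorspace class_ring M" and bs: "ordered_basis M bs" and n: "n = length bs"
    and lin: "\<And>i. i < n \<Longrightarrow> act M (bs ! i) g \<in> carrier M"
  shows "induced_matrix M bs g \<in> carrier_mat n n"
    and "i < n \<Longrightarrow> act M (bs ! i) g = basis_combination M bs (row (induced_matrix M bs g) i)"
proof -
  let ?P = "\<lambda>A. A \<in> carrier_mat (length bs) (length bs) \<and>
      (\<forall>i<length bs. act M (bs ! i) g =
        (\<Oplus>\<^bsub>M\<^esub>j\<in>{..<length bs}. A $$ (i, j) \<odot>\<^bsub>M\<^esub> bs ! j))"
  interpret M: vectorspace class_ring M by fact
  have bsc: "bs ! j \<in> carrier M" if "j < length bs" for j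
    using ordered_basis_carrier[OF M bs] that by auto
  have s: "c \<odot>\<^bsub>M\<^esub> x \<in> carrier M" if "x \<in> carrier M" for c x using that by simp
  have row: "(\<Oplus>\<^bsub>M\<^esub>j\<in>{..<length bs}. A $$ (i, j) \<odot>\<^bsub>M\<^esub> bs ! j) = basis_combination M bs (row A i)"
    if "A \<in> carrier_mat n n" "i < n" for A i
    unfolding basis_combination_def
    by (rule M.finsum_cong') (use that bsc s n in auto)
  have P_iff: "?P A \<longleftrightarrow> A \<in> carrier_mat n n \<and>
      (\<forall>i<n. act M (bs ! i) g = basis_combination M bs (row A i))" for A
    unfolding n[symmetric] using row[of A] n by auto
  have "\<exists>!A. ?P A"
    unfolding P_iff
  proof (rule ex1I, intro conjI allI impI)
    let ?A = "mat n n (\<lambda>(i, j). coordinates M bs (act M (bs ! i) g) $ j)"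
    show "?A \<in> carrier_mat n n" by simp
    fix i assume i: "i < n"
    have "row ?A i = coordinates M bs (act M (bs ! i) g)"
      using i coordinates(4)[OF M bs n lin[OF i]] by (intro eq_vecI) auto
    then show "act M (bs ! i) g = basis_combination M bs (row ?A i)"
      using coordinates(2)[OF M bs n lin[OF i]] by simp
  next
    fix A assume A: "A \<in> carrier_mat n n \<and>
      (\<forall>i<n. act M (bs ! i) g = basis_combination M bs (row A i))"
    show "A = mat n n (\<lambda>(i, j). coordinates M bs (act M (bs ! i) g) $ j)"
    proof (rule eq_matI)
      fix i j assume "i < dim_row (mat n n (\<lambda>(i, j). coordinates M bs (act M (bs ! i) g) $ j))"
        "j < dim_col (mat n n (\<lambda>(i, j). coordinates M bs (act M (bs ! i) g) $ j))"
      then have ij: "i < n" "j < n" by simp_all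
      have "row A i \<in> carrier_vec n" using A by auto
      then have "coordinates M bs (act M (bs ! i) g) = row A i"
        using A ij coordinates(3)[OF M bs n] by simp
      then show "A $$ (i, j) = mat n n (\<lambda>(i, j). coordinates M bs (act M (bs ! i) g) $ j) $$ (i, j)"
        using ij conjunct1[OF A] by auto
    qed (use A in auto)
  qed
  then have "?P (induced_matrix M bs g)"
    unfolding induced_matrix_def by (rule theI')
  then have *: "induced_matrix M bs g \<in> carrier_mat n n \<and>
      (\<forall>i<n. act M (bs ! i) g = basis_combination M bs (row (induced_matrix M bs g) i))"
    unfolding P_iff .
  then show "induced_matrix M bs g \<in> carrier_mat n n" by blast
  show "i < n \<Longrightarrow> act M (bs ! i) g = basis_combination M bs (row (induced_matrix M bs g) i)"
    using * by blast
qed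

text \<open>Coordinates identify \<open>M\<close> with the natural module, the element \<open>g\<close> acting through its induced
  matrix. On a vector with coordinates \<open>v\<close> both sides come out as the combination of the rows of that
  matrix with coefficients \<open>v\<close>.\<close>

lemma coordinates_hom:
  fixes M :: "('g, 'k::field, 'v) gmodule"
  assumes M: "vectorspace class_ring M" and bs: "ordered_basis M bs" and n: "n = length bs"
    and lin: "linear_action G M"
  shows "coordinates M bs \<in> gmodule_hom G (induced_matrix M bs) M (natural_module n)"
proof (rule gmodule_homI)
  let ?N = "natural_module n :: ('k mat, 'k, 'k vec) gmodule"
  interpret M: vectorspace class_ring M by fact
  note bsc = ordered_basis_carrier[OF M bs]
  note \<psi> = basis_combination_linear[OF M bsc n]
  note co = coordinates[OF M bs n]
  show "coordinates M bs x \<in> carrier ?N" if "x \<in> carrier M" for x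
    using co(4)[OF that] by simp
  show "coordinates M bs (x \<oplus>\<^bsub>M\<^esub> y) = coordinates M bs x \<oplus>\<^bsub>?N\<^esub> coordinates M bs y"
    if x: "x \<in> carrier M" and y: "y \<in> carrier M" for x y
  proof -
    have "x \<oplus>\<^bsub>M\<^esub> y = basis_combination M bs (coordinates M bs x + coordinates M bs y)"
      using \<psi>(2)[OF co(4)[OF x] co(4)[OF y]] co(2)[OF x] co(2)[OF y] by simp
    then show ?thesis using co(3)[OF add_carrier_vec[OF co(4)[OF x] co(4)[OF y]]] by simp
  qed
  show "coordinates M bs (c \<odot>\<^bsub>M\<^esub> x) = c \<odot>\<^bsub>?N\<^esub> coordinates M bs x"
    if x: "x \<in> carrier M" for c x
  proof -
    have "c \<odot>\<^bsub>M\<^esub> x = basis_combination M bs (c \<cdot>\<^sub>v coordinates M bs x)"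
      using \<psi>(3)[OF co(4)[OF x]] co(2)[OF x] by simp
    then show ?thesis using co(3)[OF smult_carrier_vec[THEN iffD2, OF co(4)[OF x]]] by simp
  qed
  fix g x assume g: "g \<in> G" and x: "x \<in> carrier M"
  let ?A = "induced_matrix M bs g" and ?v = "coordinates M bs x"
  have bsc': "bs ! j \<in> carrier M" if "j < n" for j using bsc that n by auto
  have s: "c \<odot>\<^bsub>M\<^esub> x \<in> carrier M" if "x \<in> carrier M" for c x using that by simp
  have act: "(\<lambda>v. act M v g) \<in> LinearCombinations.module_hom class_ring M M"
    using lin g by (simp add: linear_action_def)
  have A: "?A \<in> carrier_mat n n"
    and rowA: "\<And>i. i < n \<Longrightarrow> act M (bs ! i) g = basis_combination M bs (row ?A i)"
    using induced_matrix_props[OF M bs n linear_action_closed[OF lin g bsc']] by blast+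
  have v: "?v \<in> carrier_vec n" by (rule co(4)[OF x])
  have vN: "vectorspace class_ring ?N" by (rule vectorspace_natural_module)
  interpret N: vectorspace class_ring ?N by (rule vN)
  have \<psi>hom: "basis_combination M bs \<in> LinearCombinations.module_hom class_ring ?N M"
    using \<psi> by (simp add: LinearCombinations.module_hom_def)
  have rc: "row ?A i \<in> carrier_vec n" if "i < n" for i using A that by auto
  \<comment> \<open>The image of a row vector is the combination of the rows of the matrix.\<close>
  have tv: "transpose_mat ?A *\<^sub>v ?v = (\<Oplus>\<^bsub>?N\<^esub>i\<in>{..<n}. (?v $ i) \<cdot>\<^sub>v row ?A i)"
  proof (rule eq_vecI)
    have cl: "(\<Oplus>\<^bsub>?N\<^esub>i\<in>{..<n}. (?v $ i) \<cdot>\<^sub>v row ?A i) \<in> carrier_vec n"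
      using N.finsum_closed[of "\<lambda>i. (?v $ i) \<cdot>\<^sub>v row ?A i" "{..<n}"] rc by auto
    then show "dim_vec (transpose_mat ?A *\<^sub>v ?v) = dim_vec (\<Oplus>\<^bsub>?N\<^esub>i\<in>{..<n}. (?v $ i) \<cdot>\<^sub>v row ?A i)"
      using A by simp
    fix j assume "j < dim_vec (\<Oplus>\<^bsub>?N\<^esub>i\<in>{..<n}. (?v $ i) \<cdot>\<^sub>v row ?A i)"
    then have j: "j < n" using cl by simp
    have "(\<Oplus>\<^bsub>?N\<^esub>i\<in>{..<n}. (?v $ i) \<cdot>\<^sub>v row ?A i) $ j = (\<Sum>i<n. ((?v $ i) \<cdot>\<^sub>v row ?A i) $ j)"
      by (rule index_finsum_natural_module) (use j rc in auto)
    also have "\<dots> = (\<Sum>i<n. ?A $$ (i, j) * ?v $ i)"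
      by (rule sum.cong) (use j A in auto)
    also have "\<dots> = (transpose_mat ?A *\<^sub>v ?v) $ j"
      using A v j by (simp add: scalar_prod_def lessThan_atLeast0)
    finally show "(transpose_mat ?A *\<^sub>v ?v) $ j = (\<Oplus>\<^bsub>?N\<^esub>i\<in>{..<n}. (?v $ i) \<cdot>\<^sub>v row ?A i) $ j" ..
  qed
  have "act M x g = act M (\<Oplus>\<^bsub>M\<^esub>i\<in>{..<n}. (?v $ i) \<odot>\<^bsub>M\<^esub> bs ! i) g"
    using co(2)[OF x] by (simp add: basis_combination_def n)
  also have "\<dots> = (\<Oplus>\<^bsub>M\<^esub>i\<in>{..<n}. act M ((?v $ i) \<odot>\<^bsub>M\<^esub> bs ! i) g)"
    by (rule module_hom_finsum[OF M M act]) (auto simp: s bsc')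
  also have "\<dots> = (\<Oplus>\<^bsub>M\<^esub>i\<in>{..<n}. basis_combination M bs ((?v $ i) \<cdot>\<^sub>v row ?A i))"
  proof (rule M.finsum_cong')
    fix i assume "i \<in> {..<n}"
    then have i: "i < n" by simp
    have "act M ((?v $ i) \<odot>\<^bsub>M\<^esub> bs ! i) g = (?v $ i) \<odot>\<^bsub>M\<^esub> act M (bs ! i) g"
      using act bsc'[OF i] by (simp add: LinearCombinations.module_hom_def)
    then show "act M ((?v $ i) \<odot>\<^bsub>M\<^esub> bs ! i) g = basis_combination M bs ((?v $ i) \<cdot>\<^sub>v row ?A i)"
      using rowA[OF i] \<psi>(3)[OF rc[OF i]] by simp
  qed (use \<psi>(1) in auto)
  also have "\<dots> = basis_combination M bs (\<Oplus>\<^bsub>?N\<^esub>i\<in>{..<n}. (?v $ i) \<cdot>\<^sub>v row ?A i)"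
    by (rule module_hom_finsum[OF vN M \<psi>hom, symmetric]) (auto simp: rc)
  finally have "act M x g = basis_combination M bs (transpose_mat ?A *\<^sub>v ?v)"
    unfolding tv .
  moreover have "transpose_mat ?A *\<^sub>v ?v \<in> carrier_vec n" using A v by simp
  ultimately show "coordinates M bs (act M x g) = act ?N ?v ?A"
    using co(3) by simp
qed

text \<open>By finiteness a surjective action is injective, so the induced matrix has trivial kernel.\<close>

lemma induced_matrix_in_GL:
  fixes M :: "('g, 'k::field, 'v) gmodule"
  assumes M: "vectorspace class_ring M" and fin: "finite (carrier M)"
    and bs: "ordered_basis M bs" and n: "n = length bs" and lin: "linear_action {g} M"
    and surj: "carrier M \<subseteq> (\<lambda>x. act M x g) ` carrier M"
  shows "induced_matrix M bs g \<in> carrier (GL n)"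
proof (rule GL_memI)
  let ?N = "natural_module n :: ('k mat, 'k, 'k vec) gmodule"
  interpret M: vectorspace class_ring M by (rule M)
  have hom: "coordinates M bs \<in> gmodule_hom {g} (induced_matrix M bs) M ?N"
    by (rule coordinates_hom[OF M bs n lin])
  have co0: "coordinates M bs \<zero>\<^bsub>M\<^esub> = 0\<^sub>v n"
    using gmodule_hom_zero[OF M vectorspace_natural_module hom] by simp
  show "induced_matrix M bs g \<in> carrier_mat n n"
    using induced_matrix_props(1)[OF M bs n] linear_action_closed[OF lin]
      ordered_basis_carrier[OF M bs] n by (simp add: subset_iff)
  have inj: "inj_on (\<lambda>x. act M x g) (carrier M)" by (rule finite_surj_inj[OF fin surj])
  have act0: "act M \<zero>\<^bsub>M\<^esub> g = \<zero>\<^bsub>M\<^esub>" by (rule linear_action_zero[OF M lin]) simp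
  fix v assume v: "v \<in> carrier_vec n" and 0: "act ?N v (induced_matrix M bs g) = 0\<^sub>v n"
  define x where "x = basis_combination M bs v"
  have x: "x \<in> carrier M"
    unfolding x_def by (rule basis_combination_linear(1)[OF M ordered_basis_carrier[OF M bs] n])
  have cx: "coordinates M bs x = v" unfolding x_def by (rule coordinates(3)[OF M bs n v])
  have ax: "act M x g \<in> carrier M" by (rule linear_action_closed[OF lin _ x]) simp
  have "coordinates M bs (act M x g) = 0\<^sub>v n"
    using gmodule_homD(4)[OF hom _ x, of g] 0 cx by simp
  then have "coordinates M bs (act M x g) = coordinates M bs \<zero>\<^bsub>M\<^esub>" using co0 by simp
  then have "act M x g = act M \<zero>\<^bsub>M\<^esub> g"
    unfolding act0 by (metis coordinates(2)[OF M bs n] ax M.zero_closed)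
  then have "x = \<zero>\<^bsub>M\<^esub>" using inj x M.zero_closed by (simp add: inj_on_def)
  then show "v = 0\<^sub>v n" using cx co0 by simp
qed

section \<open>Dimension and cardinality over a finite field\<close>

lemma card_carrier_vec: "card (carrier_vec m :: 'a::finite vec set) = card (UNIV :: 'a set) ^ m"
  unfolding bij_betw_same_card[OF bij_betw_carrier_vec_lists]
  by (rule card_lists_length_eq) simp

lemma card_field_gt_1: "1 < card (UNIV :: 'a::{field,finite} set)"
proof -
  have "card {0, 1 :: 'a} \<le> card (UNIV :: 'a set)" by (rule card_mono) auto
  then show ?thesis by simp
qed

text \<open>With finite scalars the dimension is determined by the cardinality, so statements on dimensions
  reduce to injections between finite sets.\<close>

lemma card_carrier_eq:
  fixes M :: "('g, 'k::{field,finite}, 'v) gmodule"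
  assumes "vectorspace class_ring M" "finite (carrier M)"
  shows "card (carrier M) = card (UNIV :: 'k set) ^ gdim M"
proof -
  obtain bs where bs: "ordered_basis M bs" using ordered_basis_exists[OF assms] by blast
  have "card (carrier M) = card (carrier_vec (gdim M) :: 'k vec set)"
    by (rule bij_betw_same_card[OF coordinates(1)[OF assms(1) bs length_ordered_basis[OF assms(1) bs, symmetric]]])
  then show ?thesis by (simp add: card_carrier_vec)
qed

lemma gdim_mono_inj:
  fixes M :: "('g, 'k::{field,finite}, 'v) gmodule" and N :: "('h, 'k, 'w) gmodule"
  assumes "vectorspace class_ring M" "vectorspace class_ring N" "finite (carrier N)"
    and "inj_on f (carrier M)" "f ` carrier M \<subseteq> carrier N"
  shows "gdim M \<le> gdim N"
proof -
  have "finite (carrier M)" using assms(3-5) inj_on_finite by blast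
  then have "card (UNIV :: 'k set) ^ gdim M \<le> card (UNIV :: 'k set) ^ gdim N"
    using card_inj_on_le[OF assms(4,5,3)] card_carrier_eq assms(1-3) by metis
  then show ?thesis by (rule power_le_imp_le_exp[OF card_field_gt_1])
qed

lemma gdim_eq_bij:
  fixes M :: "('g, 'k::{field,finite}, 'v) gmodule" and N :: "('h, 'k, 'w) gmodule"
  assumes "vectorspace class_ring M" "vectorspace class_ring N" "finite (carrier N)"
    and "bij_betw f (carrier M) (carrier N)"
  shows "gdim M = gdim N"
proof (rule antisym)
  have fin: "finite (carrier M)" using assms(3,4) bij_betw_finite by blast
  show "gdim M \<le> gdim N"
    using assms(4) by (intro gdim_mono_inj[OF assms(1,2,3)]) (auto simp: bij_betw_def)
  show "gdim N \<le> gdim M"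
    using bij_betw_inv_into[OF assms(4)]
    by (intro gdim_mono_inj[OF assms(2,1) fin]) (auto simp: bij_betw_def)
qed

text \<open>The addition map \<open>A \<times> B \<rightarrow> M\<close> is injective when \<open>A\<close> and \<open>B\<close> meet trivially; count elements.\<close>

lemma gdim_add_le:
  fixes M :: "('g, 'k::{field,finite}, 'v) gmodule"
  assumes fin: "finite (carrier M)"
    and A: "VectorSpace.subspace class_ring A M" and B: "VectorSpace.subspace class_ring B M"
    and int: "A \<inter> B = {\<zero>\<^bsub>M\<^esub>}"
  shows "gdim (M\<lparr>carrier := A\<rparr>) + gdim (M\<lparr>carrier := B\<rparr>) \<le> gdim M"
proof -
  have M: "vectorspace class_ring M" using A by (simp add: VectorSpace.subspace_def)
  interpret M: vectorspace class_ring M by (rule M)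
  note A' = A[unfolded subspace_iff[OF M]] and B' = B[unfolded subspace_iff[OF M]]
  have neg: "\<ominus>\<^bsub>M\<^esub> x \<in> X" if "x \<in> X" "VectorSpace.subspace class_ring X M" for x X
    using that M.smult_minus_1[of x] subspace_iff[OF M, of X] by (metis subsetD)
  have "inj_on (\<lambda>(x, y). x \<oplus>\<^bsub>M\<^esub> y) (A \<times> B)"
  proof (rule inj_onI, clarify)
    fix x y x' y' assume x: "x \<in> A" "x' \<in> A" and y: "y \<in> B" "y' \<in> B"
      and eq: "x \<oplus>\<^bsub>M\<^esub> y = x' \<oplus>\<^bsub>M\<^esub> y'"
    have xc: "x \<in> carrier M" "x' \<in> carrier M" using x A' by auto
    have yc: "y \<in> carrier M" "y' \<in> carrier M" using y B' by auto
    have "x \<oplus>\<^bsub>M\<^esub> \<ominus>\<^bsub>M\<^esub> x' = (x \<oplus>\<^bsub>M\<^esub> y) \<oplus>\<^bsub>M\<^esub> (\<ominus>\<^bsub>M\<^esub> x' \<oplus>\<^bsub>M\<^esub> \<ominus>\<^bsub>M\<^esub> y)"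
      using xc yc by (simp add: M.a_ac M.r_neg M.r_neg1 M.r_neg2)
    also have "\<dots> = y' \<oplus>\<^bsub>M\<^esub> \<ominus>\<^bsub>M\<^esub> y"
      unfolding eq using xc yc
      by (simp add: M.a_assoc M.a_lcomm[of y' "\<ominus>\<^bsub>M\<^esub> x'"] M.r_neg2)
    finally have d: "x \<oplus>\<^bsub>M\<^esub> \<ominus>\<^bsub>M\<^esub> x' = y' \<oplus>\<^bsub>M\<^esub> \<ominus>\<^bsub>M\<^esub> y" .
    have "x \<oplus>\<^bsub>M\<^esub> \<ominus>\<^bsub>M\<^esub> x' \<in> A" using x A' neg[OF x(2) A] by simp
    moreover have "x \<oplus>\<^bsub>M\<^esub> \<ominus>\<^bsub>M\<^esub> x' \<in> B" unfolding d using y B' neg[OF y(1) B] by simp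
    ultimately have z: "x \<oplus>\<^bsub>M\<^esub> \<ominus>\<^bsub>M\<^esub> x' = \<zero>\<^bsub>M\<^esub>" using int by blast
    have "x = x'" using z xc M.minus_equality M.minus_minus M.a_comm M.a_inv_closed by metis
    moreover have "y' = y"
      using z[unfolded d] yc M.minus_equality M.minus_minus M.a_comm M.a_inv_closed by metis
    ultimately show "x = x' \<and> y = y'" by simp
  qed
  moreover have "(\<lambda>(x, y). x \<oplus>\<^bsub>M\<^esub> y) ` (A \<times> B) \<subseteq> carrier M"
    using A' B' by auto
  ultimately have "card (A \<times> B) \<le> card (carrier M)" using fin by (rule card_inj_on_le)
  moreover have "finite A" "finite B" using fin A' B' finite_subset by auto
  ultimately have "card (UNIV :: 'k set) ^ (gdim (M\<lparr>carrier := A\<rparr>) + gdim (M\<lparr>carrier := B\<rparr>))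
      \<le> card (UNIV :: 'k set) ^ gdim M"
    using card_carrier_eq[OF vectorspace_restrict[OF A]] card_carrier_eq[OF vectorspace_restrict[OF B]]
      card_carrier_eq[OF M fin]
    by (simp add: card_cartesian_product power_add)
  then show ?thesis by (rule power_le_imp_le_exp[OF card_field_gt_1])
qed

section \<open>The factor containing both fat submodules\<close>

text \<open>Projection to \<open>N = W / U\<close> is injective on \<open>E\<close>, which meets \<open>U\<close> trivially. Followed by coordinates
  it embeds \<open>E\<close> equivariantly into the natural module of the induced matrices. The image is
  the submodule that fatness demands: it has the dimension of \<open>E\<close>, and \<open>dim N \<le> d\<close>, so it still
  has more than half of the dimension of the ambient space.\<close>

lemma fat_element_on_factor:
  fixes S :: "'a::{field,finite} mat set" and d :: nat and W U :: "'a vec set"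
  defines "V \<equiv> natural_module d" and "N \<equiv> quotient_module ((natural_module d)\<lparr>carrier := W\<rparr>) U"
  assumes S: "S \<subseteq> carrier (GL d)"
    and W: "gsubmodule S V W" and U: "gsubmodule S V U" and UW: "U \<subseteq> W"
    and bs: "ordered_basis N bs" and g: "g \<in> S"
    and E: "gsubmodule {g} V E" and irr: "irreducible_module {g} (V\<lparr>carrier := E\<rparr>)"
    and EW: "E \<subseteq> W" and EU: "E \<inter> U = {0\<^sub>v d}"
    and half: "real d / 2 < real (gdim (V\<lparr>carrier := E\<rparr>))"
  shows "fat_element (gdim N) (gdim (V\<lparr>carrier := E\<rparr>)) (induced_matrix N bs g)"
    and "gdim (V\<lparr>carrier := E\<rparr>) \<le> gdim N"
proof -
  let ?W = "V\<lparr>carrier := W\<rparr>" and ?E = "V\<lparr>carrier := E\<rparr>" and ?A = "induced_matrix N bs"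
  let ?n = "gdim N"
  let ?F = "natural_module ?n :: ('a mat, 'a, 'a vec) gmodule"
  have N_def': "N = quotient_module ?W U" by (simp add: N_def V_def)
  have linV: "linear_action S V"
    unfolding V_def using S GL_carrier by (intro linear_action_natural_module) blast
  have sW: "VectorSpace.subspace class_ring W V" using W by (simp add: gsubmodule_def)
  have sE: "VectorSpace.subspace class_ring E V" using E by (simp add: gsubmodule_def)
  have vV: "vectorspace class_ring V" unfolding V_def by (rule vectorspace_natural_module)
  have vW: "vectorspace class_ring ?W" by (rule vectorspace_restrict[OF sW])
  have vE: "vectorspace class_ring ?E" by (rule vectorspace_restrict[OF sE])
  have vF: "vectorspace class_ring ?F" by (rule vectorspace_natural_module)
  have linW: "linear_action S ?W" by (rule linear_action_restrict[OF linV W])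
  have UW': "gsubmodule S ?W U" by (simp add: gsubmodule_restrict_iff[OF sW] U UW)
  have vN: "vectorspace class_ring N"
    unfolding N_def' using UW' by (intro vectorspace_quotient_module) (simp add: gsubmodule_def)
  have linN: "linear_action S N"
    unfolding N_def' by (rule linear_action_quotient[OF UW' linW])
  define \<pi> where "\<pi> = (\<lambda>x. U +>\<^bsub>?W\<^esub> x)"
  note quot = quotient_module_hom[OF UW' linW[unfolded linear_action_def, rule_format]]
  have \<pi>: "\<pi> \<in> gmodule_hom S id ?W N" and img: "\<pi> ` W = carrier N"
    using quot(1,2) by (simp_all add: \<pi>_def N_def')
  have ker: "\<pi> x = \<zero>\<^bsub>N\<^esub> \<longleftrightarrow> x \<in> U" if "x \<in> W" for x
    using quot(3)[of x] that by (simp add: \<pi>_def N_def')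
  have W_vec: "W \<subseteq> carrier_vec d" using gsubmodule_carrier[OF W] by (simp add: V_def)
  have finW: "finite W" using W_vec finite_carrier_vec by (rule finite_subset)
  have finN: "finite (carrier N)" unfolding img[symmetric] using finW by (rule finite_imageI)
  have n: "?n = length bs" by (rule length_ordered_basis[OF vN bs, symmetric])
  let ?c = "coordinates N bs"
  have c: "?c \<in> gmodule_hom S ?A N ?F" by (rule coordinates_hom[OF vN bs n linN])
  have c_bij: "bij_betw ?c (carrier N) (carrier_vec ?n)" by (rule coordinates(1)[OF vN bs n])
  have c\<pi>: "?c \<circ> \<pi> \<in> gmodule_hom S ?A ?W ?F"
    using gmodule_hom_comp[OF \<pi>, of ?c ?A ?F] c by simp
  have f: "?c \<circ> \<pi> \<in> gmodule_hom {g} ?A ?E ?F"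
    using gmodule_hom_restrict[OF c\<pi>, of E "{g}"] EW g by simp
  have inj\<pi>: "inj_on \<pi> E"
  proof -
    have "\<pi> \<in> gmodule_hom {g} id ?E N"
      using gmodule_hom_restrict[OF \<pi>, of E "{g}"] EW g by simp
    then have "inj_on \<pi> E \<longleftrightarrow> {v \<in> E. \<pi> v = \<zero>\<^bsub>N\<^esub>} = {\<zero>\<^bsub>V\<^esub>}"
      using gmodule_hom_inj_iff[OF vE vN] by simp
    moreover have "{v \<in> E. \<pi> v = \<zero>\<^bsub>N\<^esub>} = E \<inter> U" using ker EW by auto
    ultimately show ?thesis using EU by (simp add: V_def)
  qed
  have imgE: "\<pi> ` E \<subseteq> carrier N" unfolding img[symmetric] using EW by (rule image_mono)
  have injf: "inj_on (?c \<circ> \<pi>) E"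
    by (rule comp_inj_on[OF inj\<pi> inj_on_subset[OF bij_betw_imp_inj_on[OF c_bij] imgE]])
  show le: "gdim ?E \<le> gdim N"
    by (rule gdim_mono_inj[OF vE vN finN, of \<pi>]) (simp_all add: inj\<pi> imgE)
  let ?X = "(?c \<circ> \<pi>) ` E"
  have EE: "gsubmodule {g} ?E E" by (simp add: gsubmodule_restrict_iff[OF sE] E)
  have X: "gsubmodule {?A g} ?F ?X" using gsubmodule_image[OF vF f EE] by simp
  have sX: "VectorSpace.subspace class_ring ?X ?F" using X by (simp add: gsubmodule_def)
  have vX: "vectorspace class_ring (?F\<lparr>carrier := ?X\<rparr>)" by (rule vectorspace_restrict[OF sX])
  have fX: "?c \<circ> \<pi> \<in> gmodule_hom {g} ?A ?E (?F\<lparr>carrier := ?X\<rparr>)"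
    by (rule gmodule_hom_corestrict[OF f]) simp
  have bijX: "bij_betw (?c \<circ> \<pi>) (carrier ?E) (carrier (?F\<lparr>carrier := ?X\<rparr>))"
    using injf by (simp add: bij_betw_def)
  have stable: "act ?E v h \<in> carrier ?E" if "h \<in> {g}" "v \<in> carrier ?E" for h v
    using E that by (simp add: gsubmodule_def)
  have irrX: "irreducible_module {?A g} (?F\<lparr>carrier := ?X\<rparr>)"
    using irreducible_module_iso[OF vE vX fX bijX stable irr] by simp
  have finX: "finite ?X"
    using finite_subset[OF EW finW] by (rule finite_imageI)
  have dimX: "gdim (?F\<lparr>carrier := ?X\<rparr>) = gdim ?E"
    using gdim_eq_bij[OF vE vX _ bijX] finX by simp
  have gGL: "g \<in> carrier (GL d)" using g S by blast
  have AGL: "?A g \<in> carrier (GL ?n)"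
  proof (rule induced_matrix_in_GL[OF vN finN bs n])
    show "linear_action {g} N" using linN g by (simp add: linear_action_def)
    \<comment> \<open>An injective map of the finite set \<open>W\<close> into itself is onto, and then so is the map that it
      induces on cosets.\<close>
    have "(\<lambda>w. act V w g) ` W \<subseteq> W" using W g unfolding gsubmodule_def by blast
    then have Wg: "(\<lambda>w. act V w g) ` W = W"
      using inj_on_subset[OF inj_on_act_GL[OF gGL] W_vec] unfolding V_def
      by (intro endo_inj_surj[OF finW]) simp_all
    show "carrier N \<subseteq> (\<lambda>x. act N x g) ` carrier N"
    proof
      fix Y assume "Y \<in> carrier N"
      then obtain w where w: "w \<in> W" "Y = \<pi> w" unfolding img[symmetric] by (rule imageE)
      from w(1) have "w \<in> (\<lambda>w. act V w g) ` W" unfolding Wg .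
      then obtain w' where w': "w' \<in> W" "w = act V w' g" by (rule imageE)
      have "Y = act N (\<pi> w') g"
        using gmodule_homD(4)[OF \<pi> g, of w'] w w' by simp
      moreover have "\<pi> w' \<in> carrier N" unfolding img[symmetric] using w'(1) by (rule imageI)
      ultimately show "Y \<in> (\<lambda>x. act N x g) ` carrier N" by (rule image_eqI)
    qed
  qed
  \<comment> \<open>This turns \<open>e > d / 2\<close> into \<open>e > n / 2\<close>.\<close>
  have nd: "?n \<le> d"
  proof -
    have "card (carrier N) \<le> card W" unfolding img[symmetric] by (rule card_image_le[OF finW])
    also have "\<dots> \<le> card (carrier_vec d :: 'a vec set)" by (rule card_mono[OF finite_carrier_vec W_vec])
    finally have "card (UNIV :: 'a set) ^ ?n \<le> card (UNIV :: 'a set) ^ d"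
      unfolding card_carrier_eq[OF vN finN] card_carrier_vec .
    then show ?thesis by (rule power_le_imp_le_exp[OF card_field_gt_1])
  qed
  have incl: "{?A g} \<subseteq> generate (GL ?n) {?A g}" by (auto intro: generate.incl)
  have "{?A g} \<subseteq> carrier (GL ?n)" using AGL by simp
  then have "gsubmodule (generate (GL ?n) {?A g}) ?F ?X"
    using X by (simp add: gsubmodule_generate_iff)
  moreover have "irreducible_module (generate (GL ?n) {?A g}) (?F\<lparr>carrier := ?X\<rparr>)"
    by (rule irreducible_module_mono[OF irrX incl])
  ultimately show "fat_element ?n (gdim ?E) (?A g)"
    unfolding fat_element_def using AGL half nd le dimX by fastforce
qed

lemma irreducible_pair_on_factor:
  fixes N :: "('g, 'a::{field,finite}, 'v) gmodule"
  assumes N: "vectorspace class_ring N" and bs: "ordered_basis N bs"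
    and lin: "linear_action {g1, g2} N" and irr: "irreducible_module {g1, g2} N"
  shows "irreducible_pair (gdim N) (induced_matrix N bs g1, induced_matrix N bs g2)"
proof -
  let ?n = "gdim N" and ?A = "induced_matrix N bs"
  let ?F = "natural_module ?n :: ('a mat, 'a, 'a vec) gmodule"
  have n: "?n = length bs" by (rule length_ordered_basis[OF N bs, symmetric])
  have "bij_betw (coordinates N bs) (carrier N) (carrier ?F)"
    using coordinates(1)[OF N bs n] by simp
  then have "irreducible_module (?A ` {g1, g2}) ?F"
    by (rule irreducible_module_iso[OF N vectorspace_natural_module coordinates_hom[OF N bs n lin]
        _ linear_action_closed[OF lin] irr])
  then have "irreducible_module {?A g1, ?A g2} ?F" by simp
  then have "irreducible_module (generate (GL ?n) {?A g1, ?A g2}) ?F"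
    by (rule irreducible_module_mono) (auto intro: generate.incl)
  then show ?thesis by (simp add: irreducible_pair_def)
qed

theorem theorem1p3:
  fixes q d e1 e2 :: nat and g1 g2 :: "'a::{field,finite} mat"
  assumes "primepow q" and "card (UNIV :: 'a set) = q"
    and "1 < real d / 2"
    and "real d / 2 < real e1" and "e1 \<le> d"
    and "real d / 2 < real e2" and "e2 \<le> d"
    and "g1 \<in> carrier (GL d)" and "g2 \<in> carrier (GL d)"
    and "fat_pair d e1 e2 (g1, g2)"
  shows "\<exists>N n. composition_factor (generate (GL d) {g1, g2}) (natural_module d) N \<and>
    n = gdim N \<and> max e1 e2 \<le> n \<and> real d / 2 < real (max e1 e2) \<and>
    (\<forall>bs. ordered_basis N bs \<longrightarrow>
      (let p = (induced_matrix N bs g1, induced_matrix N bs g2)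
       in irreducible_pair n p \<and> fat_pair n e1 e2 p))"
proof -
  let ?V = "natural_module d :: ('a mat, 'a, 'a vec) gmodule"
  let ?S = "{g1, g2}" and ?G = "generate (GL d) {g1, g2}"
  interpret GL: group "GL d :: 'a mat monoid" by (rule GL_group)
  have S: "?S \<subseteq> carrier (GL d)" using assms(8,9) by blast
  have SG: "?S \<subseteq> ?G" by (auto intro: generate.incl)
  have G_sub: "gsubmodule ?G ?V = gsubmodule ?S ?V"
    by (rule ext, rule gsubmodule_generate_iff[OF S])
  have vV: "vectorspace class_ring ?V" by (rule vectorspace_natural_module)
  have finV: "finite (carrier ?V)" by (simp add: finite_carrier_vec)
  have linG: "linear_action ?G ?V"
    using GL.generate_incl[OF S] GL_carrier by (intro linear_action_natural_module) blast
  have linS: "linear_action ?S ?V" using linG SG unfolding linear_action_def by blast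
  \<comment> \<open>Replace the cyclic group in the definition of fatness by its generator.\<close>
  have fat: "\<exists>E. gsubmodule {g} ?V E \<and> irreducible_module {g} (?V\<lparr>carrier := E\<rparr>) \<and>
      gdim (?V\<lparr>carrier := E\<rparr>) = e" if "fat_element d e g" for g e
  proof -
    obtain E where E: "gsubmodule (generate (GL d) {g}) ?V E"
      "irreducible_module (generate (GL d) {g}) (?V\<lparr>carrier := E\<rparr>)"
      "gdim (?V\<lparr>carrier := E\<rparr>) = e"
      using \<open>fat_element d e g\<close> unfolding fat_element_def by blast
    have g: "{g} \<subseteq> carrier (GL d)" using that by (simp add: fat_element_def)
    have sE: "VectorSpace.subspace class_ring E ?V" using E(1) by (simp add: gsubmodule_def)
    have "irreducible_module {g} (?V\<lparr>carrier := E\<rparr>)"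
      using E(2) unfolding irreducible_restrict_iff[OF sE] gsubmodule_generate_iff[OF g] .
    moreover have "gsubmodule {g} ?V E" using E(1) unfolding gsubmodule_generate_iff[OF g] .
    ultimately show ?thesis using E(3) by (intro exI conjI)
  qed
  have fatp: "fat_element d e1 g1" "fat_element d e2 g2"
    using assms(10) by (simp_all add: fat_pair_def)
  obtain E1 where E1: "gsubmodule {g1} ?V E1" "irreducible_module {g1} (?V\<lparr>carrier := E1\<rparr>)"
    and dim1: "gdim (?V\<lparr>carrier := E1\<rparr>) = e1"
    using fat[OF fatp(1)] by (elim exE conjE)
  obtain E2 where E2: "gsubmodule {g2} ?V E2" "irreducible_module {g2} (?V\<lparr>carrier := E2\<rparr>)"
    and dim2: "gdim (?V\<lparr>carrier := E2\<rparr>) = e2"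
    using fat[OF fatp(2)] by (elim exE conjE)
  obtain Ws where Ws: "composition_series ?G ?V Ws"
    using composition_series_exists[OF vV finV linG] by blast
  obtain i where i: "Suc i < length Ws" "E1 \<subseteq> Ws ! Suc i" "E1 \<inter> Ws ! i = {\<zero>\<^bsub>?V\<^esub>}"
    using irreducible_embeds_in_factor[OF Ws _ E1] SG by (metis insert_subset empty_subsetI)
  obtain j where j: "Suc j < length Ws" "E2 \<subseteq> Ws ! Suc j" "E2 \<inter> Ws ! j = {\<zero>\<^bsub>?V\<^esub>}"
    using irreducible_embeds_in_factor[OF Ws _ E2] SG by (metis insert_subset empty_subsetI)
  have V_dim: "gdim ?V = d"
  proof -
    have "card (UNIV :: 'a set) ^ gdim ?V = card (UNIV :: 'a set) ^ d"
      using card_carrier_eq[OF vV finV] by (simp add: card_carrier_vec)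
    then show ?thesis using card_field_gt_1[where 'a = 'a] by (simp add: power_inject_exp)
  qed
  have E12: "E1 \<inter> E2 \<noteq> {\<zero>\<^bsub>?V\<^esub>}"
  proof
    assume "E1 \<inter> E2 = {\<zero>\<^bsub>?V\<^esub>}"
    then have "e1 + e2 \<le> d"
      using gdim_add_le[OF finV, of E1 E2] E1(1) E2(1) dim1 dim2 V_dim by (simp add: gsubmodule_def)
    then show False using assms(4,6) by linarith
  qed
  have zero: "\<zero>\<^bsub>?V\<^esub> \<in> E1 \<inter> E2" by (rule IntI[OF gsubmodule_zero[OF E1(1)] gsubmodule_zero[OF E2(1)]])
  \<comment> \<open>If the factors differ, the term below the later one contains one of \<open>E1\<close>, \<open>E2\<close> and meets the
    other trivially.\<close>
  have "\<not> i < j"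
  proof
    assume "i < j"
    then have "E1 \<subseteq> Ws ! j" using i(2) composition_series_mono[OF Ws, of "Suc i" j] j(1) by auto
    then show False using E12 j(3) zero by blast
  qed
  moreover have "\<not> j < i"
  proof
    assume "j < i"
    then have "E2 \<subseteq> Ws ! i" using j(2) composition_series_mono[OF Ws, of "Suc j" i] i(1) by auto
    then show False using E12 i(3) zero by blast
  qed
  ultimately have ij: "j = i" by simp
  let ?W = "Ws ! Suc i" and ?U = "Ws ! i"
  define N where "N = quotient_module (?V\<lparr>carrier := ?W\<rparr>) ?U"
  have factor: "composition_factor ?G ?V N"
    unfolding composition_factor_def N_def using Ws i(1) by blast
  have WG: "gsubmodule ?G ?V ?W" and UG: "gsubmodule ?G ?V ?U" and UW: "?U \<subseteq> ?W"
    and irrG: "irreducible_module ?G N"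
    using Ws i(1) by (simp_all add: composition_series_def N_def)
  have W: "gsubmodule ?S ?V ?W" and U: "gsubmodule ?S ?V ?U" using WG UG by (simp_all only: G_sub)
  \<comment> \<open>The lattice criterion sees only the submodules, which are the same for \<open>?G\<close> and \<open>?S\<close>.\<close>
  have irr: "irreducible_module ?S N"
    using irrG unfolding N_def irreducible_quotient_iff[OF linG WG UG UW]
      irreducible_quotient_iff[OF linS W U UW] G_sub .
  have sW: "VectorSpace.subspace class_ring ?W ?V" using W by (simp add: gsubmodule_def)
  have UW': "gsubmodule ?S (?V\<lparr>carrier := ?W\<rparr>) ?U" by (simp add: gsubmodule_restrict_iff[OF sW] U UW)
  have vN: "vectorspace class_ring N"
    unfolding N_def using UW' by (intro vectorspace_quotient_module) (simp add: gsubmodule_def)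
  have linN: "linear_action ?S N"
    unfolding N_def by (rule linear_action_quotient[OF UW' linear_action_restrict[OF linS W]])
  have fat1: "fat_element (gdim N) e1 (induced_matrix N bs g1) \<and> e1 \<le> gdim N"
    if "ordered_basis N bs" for bs
    using fat_element_on_factor[OF S W U UW that[unfolded N_def] _ E1 i(2)] i(3) assms(4) dim1
    by (simp add: N_def)
  have fat2: "fat_element (gdim N) e2 (induced_matrix N bs g2) \<and> e2 \<le> gdim N"
    if "ordered_basis N bs" for bs
    using fat_element_on_factor[OF S W U UW that[unfolded N_def] _ E2 j(2)[unfolded ij]]
      j(3)[unfolded ij] assms(6) dim2
    by (simp add: N_def)
  obtain bs where "ordered_basis N bs"
    using composition_factor_has_ordered_basis[OF factor] by blast
  then have "max e1 e2 \<le> gdim N" using fat1 fat2 by simp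
  moreover have "real d / 2 < real (max e1 e2)" using assms(4) by simp
  ultimately show ?thesis
    using factor fat1 fat2 irreducible_pair_on_factor[OF vN _ linN irr]
    by (intro exI[of _ N] exI[of _ "gdim N"]) (simp add: fat_pair_def)
qed

end
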